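(* Let $A=T(a)+E_a\in\mathcal{CQT}$, and let $f(x)=\sum_{i=0}^{+\infty}f_ix^i$ be a complex function analytic in the open disk $\mathbb D(\rho)=\{x\in\mathbb C: |x|<\rho\}$. If $\|A\|_{\mathcal{CQT}}<\rho$, then $f(A)=\sum_{i=0}^{+\infty}f_iA^i$ is well defined (the series converges in the norm $\|\cdot\|_{\mathcal{CQT}}$), belongs to $\mathcal{CQT}$, and \[ f(A)=T(f(a))+E_{f(a)},\qquad E_{f(a)}\in\mathcal F, \] where $f(a)$ denotes the function $z\mapsto f(a(z))$. Furthermore, if $A\in\mathcal{AQT}$ then $f(A)\in\mathcal{AQT}$; more precisely, there exists an open annulus $\mathbb A(r,R)=\{z\in\mathbb C: r<|z|<R\}$ containing the unit circle $\mathbb T$ such that $f(a(z))$ is well defined and analytic for $z\in\mathbb A(r,R)$.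
   Context: $\mathbb T=\{z\in\mathbb C:|z|=1\}$; $\mathbb Z^+$ is the set of positive integers. The Wiener class $\mathcal W$ is the set of complex Laurent series $a(z)=\sum_{i\in\mathbb Z}a_iz^i$ (viewed as functions on $\mathbb T$) with $\|a\|_{\mathcal W}:=\sum_{i\in\mathbb Z}|a_i|<\infty$. $\mathcal W_1:=\{a\in\mathcal W: a'\in\mathcal W\}$, where $a'(z)=\sum_{i} i a_i z^{i-1}$, so $\|a'\|_{\mathcal W}=\sum_i|i a_i|$. For $a\in\mathcal W$, $T(a)=(t_{i,j})_{i,j\in\mathbb Z^+}$ is the semi-infinite Toeplitz matrix with $t_{i,j}=a_{j-i}$. $\mathcal F$ is the set of semi-infinite complex matrices $F=(f_{i,j})_{i,j\in\mathbb Z^+}$ with $\|F\|_{\mathcal F}:=\sum_{i,j}|f_{i,j}|<\infty$. $\mathcal{CQT}$ is the set of matrices $A=T(a)+E$ with $a\in\mathcal W_1$ and $E\in\mathcal F$ (the pair $(a,E)$ is uniquely determined by $A$), with norm $\|T(a)+E\|_{\mathcal{CQT}}:=\|a\|_{\mathcal W}+\|a'\|_{\mathcal W}+\|E\|_{\mathcal F}$. $\mathcal{AQT}$ is the set of matrices $T(a)+E$ with $E\in\mathcal F$ and $a(z)$ analytic in an open annulus containing $\mathbb T$. It is known that $(\mathcal{CQT},\|\cdot\|_{\mathcal{CQT}})$ is a Banach algebra with $\|AB\|_{\mathcal{CQT}}\le\|A\|_{\mathcal{CQT}}\|B\|_{\mathcal{CQT}}$. *)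

theory Defs
  imports "HOL-Complex_Analysis.Complex_Analysis" "HOL-Library.Function_Algebras"
begin

text \<open>
  A Laurent series is represented by its coefficients; the function it defines is
  \<open>laurent_eval a\<close>. On the unit circle, the members of \<open>wiener\<close> converge absolutely.
\<close>

type_synonym laurent = "int \<Rightarrow> complex"

definition laurent_eval :: "laurent \<Rightarrow> complex \<Rightarrow> complex" where
  "laurent_eval a z = (\<Sum>\<^sub>\<infinity>i. a i * z powi i)"

definition wiener :: "laurent set" where
  "wiener = {a. (\<lambda>i. norm (a i)) summable_on UNIV}"

definition wiener_norm :: "laurent \<Rightarrow> real" where
  "wiener_norm a = (\<Sum>\<^sub>\<infinity>i. norm (a i))"

text \<open>The coefficients of \<open>a'(z) = \<Sum>\<^sub>i i a\<^sub>i z\<^bsup>i-1\<^esup>\<close>.\<close>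

definition laurent_deriv :: "laurent \<Rightarrow> laurent" where
  "laurent_deriv a = (\<lambda>k. of_int (k + 1) * a (k + 1))"

definition wiener1 :: "laurent set" where
  "wiener1 = {a \<in> wiener. laurent_deriv a \<in> wiener}"

definition annulus :: "real \<Rightarrow> real \<Rightarrow> complex set" where
  "annulus r R = {z. r < norm z \<and> norm z < R}"

definition laurent_analytic_on :: "laurent \<Rightarrow> complex set \<Rightarrow> bool" where
  "laurent_analytic_on a S \<longleftrightarrow>
     (\<forall>z\<in>S. (\<lambda>i. a i * z powi i) summable_on UNIV) \<and> laurent_eval a analytic_on S"

text \<open>
  Rows and columns are numbered from 0 rather than from 1. Sums and differences of matrices
  are the pointwise ones of \<open>Function_Algebras\<close>; the pointwise product and unit of that
  theory are not used.
\<close>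

type_synonym semi_matrix = "nat \<Rightarrow> nat \<Rightarrow> complex"

definition toeplitz :: "laurent \<Rightarrow> semi_matrix" where
  "toeplitz a = (\<lambda>i j. a (int j - int i))"

definition mat_scale :: "complex \<Rightarrow> semi_matrix \<Rightarrow> semi_matrix" where
  "mat_scale c A = (\<lambda>i j. c * A i j)"

definition mat_id :: semi_matrix where
  "mat_id = (\<lambda>i j. if i = j then 1 else 0)"

definition mat_mult :: "semi_matrix \<Rightarrow> semi_matrix \<Rightarrow> semi_matrix" where
  "mat_mult A B = (\<lambda>i j. \<Sum>\<^sub>\<infinity>k. A i k * B k j)"

primrec mat_pow :: "semi_matrix \<Rightarrow> nat \<Rightarrow> semi_matrix" where
  "mat_pow A 0 = mat_id"
| "mat_pow A (Suc n) = mat_mult A (mat_pow A n)"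

definition Fmat :: "semi_matrix set" where
  "Fmat = {E. (\<lambda>(i, j). norm (E i j)) summable_on UNIV}"

definition Fmat_norm :: "semi_matrix \<Rightarrow> real" where
  "Fmat_norm E = (\<Sum>\<^sub>\<infinity>(i, j). norm (E i j))"

definition CQT :: "semi_matrix set" where
  "CQT = {toeplitz a + E | a E. a \<in> wiener1 \<and> E \<in> Fmat}"

definition AQT :: "semi_matrix set" where
  "AQT = {toeplitz a + E | a E. E \<in> Fmat \<and>
            (\<exists>r R. 0 \<le> r \<and> r < 1 \<and> 1 < R \<and> laurent_analytic_on a (annulus r R))}"

text \<open>
  The decomposition of a member of \<open>CQT\<close> is unique, so the description below determines
  its symbol; the lemma \<open>cqt_norm_eq\<close> confirms the resulting formula for the norm.
\<close>

definition cqt_symbol :: "semi_matrix \<Rightarrow> laurent" where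
  "cqt_symbol A = (THE a. a \<in> wiener1 \<and> A - toeplitz a \<in> Fmat)"

definition cqt_norm :: "semi_matrix \<Rightarrow> real" where
  "cqt_norm A = wiener_norm (cqt_symbol A) + wiener_norm (laurent_deriv (cqt_symbol A))
                + Fmat_norm (A - toeplitz (cqt_symbol A))"

definition cqt_sums :: "(nat \<Rightarrow> semi_matrix) \<Rightarrow> semi_matrix \<Rightarrow> bool" where
  "cqt_sums M S \<longleftrightarrow> (\<forall>n. M n \<in> CQT) \<and> S \<in> CQT \<and>
     (\<lambda>n. cqt_norm ((\<Sum>i<n. M i) - S)) \<longlonglongrightarrow> 0"

definition cqt_suminf :: "(nat \<Rightarrow> semi_matrix) \<Rightarrow> semi_matrix" where
  "cqt_suminf M = (THE S. cqt_sums M S)"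

definition mat_powser :: "(nat \<Rightarrow> complex) \<Rightarrow> semi_matrix \<Rightarrow> semi_matrix" where
  "mat_powser c A = cqt_suminf (\<lambda>i. mat_scale (c i) (mat_pow A i))"

lemma Fmat_diff:
  assumes "E \<in> Fmat" "E' \<in> Fmat"
  shows "E - E' \<in> Fmat"
proof -
  have "(\<lambda>p. norm (E (fst p) (snd p)) + norm (E' (fst p) (snd p))) summable_on UNIV"
    using assms by (intro summable_on_add) (simp_all add: Fmat_def case_prod_unfold)
  then have "(\<lambda>p. norm ((E - E') (fst p) (snd p))) summable_on UNIV"
    by (rule summable_on_comparison_test) (auto intro: norm_triangle_ineq4)
  then show ?thesis
    by (simp add: Fmat_def case_prod_unfold)
qed

lemma toeplitz_Fmat_imp_zero:
  assumes "toeplitz c \<in> Fmat"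
  shows "c k = 0"
proof -
  define h where "h = (\<lambda>n. (n + nat (- k), n + nat k))"
  have "(\<lambda>(i, j). norm (toeplitz c i j)) summable_on range h"
    using assms by (auto simp: Fmat_def intro: summable_on_subset_banach)
  moreover have "inj h"
    by (auto simp: h_def inj_def)
  ultimately have "((\<lambda>(i, j). norm (toeplitz c i j)) \<circ> h) summable_on UNIV"
    by (simp add: summable_on_reindex)
  moreover have "(\<lambda>(i, j). norm (toeplitz c i j)) \<circ> h = (\<lambda>n. norm (c k))"
    by (auto simp: h_def toeplitz_def)
  ultimately have "summable (\<lambda>n::nat. norm (c k))"
    by (simp add: summable_on_UNIV_nonneg_real_iff)
  then show ?thesis
    by (simp add: summable_const_iff)
qed

lemma cqt_symbol_eq:
  assumes "a \<in> wiener1" "E \<in> Fmat"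
  shows "cqt_symbol (toeplitz a + E) = a"
  unfolding cqt_symbol_def
proof (rule the_equality)
  show "a \<in> wiener1 \<and> toeplitz a + E - toeplitz a \<in> Fmat"
    using assms by simp
next
  fix b
  assume b: "b \<in> wiener1 \<and> toeplitz a + E - toeplitz b \<in> Fmat"
  have "toeplitz (a - b) = (toeplitz a + E - toeplitz b) - E"
    by (auto simp: toeplitz_def fun_eq_iff)
  then have "toeplitz (a - b) \<in> Fmat"
    using b assms(2) by (metis Fmat_diff)
  then have "(a - b) k = 0" for k
    by (rule toeplitz_Fmat_imp_zero)
  then show "b = a"
    by (auto simp: fun_eq_iff)
qed

lemma cqt_norm_eq:
  assumes "a \<in> wiener1" "E \<in> Fmat"
  shows "cqt_norm (toeplitz a + E) = wiener_norm a + wiener_norm (laurent_deriv a) + Fmat_norm E"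
  using assms by (simp add: cqt_norm_def cqt_symbol_eq)

end

theory Submission
  imports Defs
begin

text \<open>
  Multiplying \<open>(T(a) + E) (T(b) + F)\<close> gives \<open>T(ab)\<close> plus terms with a factor in \<open>Fmat\<close> minus a
  product of two Hankel matrices, whose norms are at most \<open>\<parallel>a'\<parallel>\<close> and \<open>\<parallel>b'\<parallel>\<close>; this makes the norm
  submultiplicative. So \<open>\<Sum> c\<^sub>n A\<^bsup>n\<^esup>\<close> converges absolutely, symbols and corrections separately, and the
  limit symbol is \<open>f \<circ> a\<close> because evaluation of Laurent series is a homomorphism, continuous for
  the weighted \<open>\<ell>\<^sup>1\<close> norm \<open>\<Sum>\<^sub>k t\<^bsup>|k|\<^esup> |a\<^sub>k|\<close> on the annulus \<open>1/t \<le> |z| \<le> t\<close>. If \<open>a\<close> is analytic near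
  the circle, this norm is finite for some \<open>t > 1\<close> and, by convexity in \<open>t\<close>, still less than \<open>\<rho>\<close>
  for \<open>t\<close> close to 1, where the same argument applies on the annulus.
\<close>

section \<open>Weighted absolutely summable families\<close>

text \<open>One scale of spaces covers every norm in use: weight 1 on integers gives
  \<open>wiener\<close>, weight 1 on index pairs gives \<open>Fmat\<close>, weight 1 + |k| gives
  \<open>wiener1\<close>, and t^|k| governs evaluation on an annulus.\<close>

definition weighted_l1 :: "('k \<Rightarrow> real) \<Rightarrow> ('k \<Rightarrow> complex) set" where
  "weighted_l1 w = {x. (\<lambda>k. w k * norm (x k)) summable_on UNIV}"

definition weighted_norm :: "('k \<Rightarrow> real) \<Rightarrow> ('k \<Rightarrow> complex) \<Rightarrow> real" where
  "weighted_norm w x = (\<Sum>\<^sub>\<infinity>k. w k * norm (x k))"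

lemma nonneg_infsum_inj:
  fixes f :: "'b \<Rightarrow> real"
  assumes "f summable_on T" "\<And>y. y \<in> T \<Longrightarrow> 0 \<le> f y" "inj_on j S" "j ` S \<subseteq> T"
  shows "(\<lambda>x. f (j x)) summable_on S" "(\<Sum>\<^sub>\<infinity>x\<in>S. f (j x)) \<le> infsum f T"
proof -
  have *: "f summable_on j ` S"
    using assms summable_on_subset_banach by blast
  then show "(\<lambda>x. f (j x)) summable_on S"
    using summable_on_reindex[OF assms(3), of f] by (simp add: o_def)
  have "(\<Sum>\<^sub>\<infinity>x\<in>S. f (j x)) = infsum f (j ` S)"
    using infsum_reindex[OF assms(3), of f] by (simp add: o_def)
  also have "\<dots> \<le> infsum f T"
    by (rule infsum_mono_neutral) (use * assms in auto)
  finally show "(\<Sum>\<^sub>\<infinity>x\<in>S. f (j x)) \<le> infsum f T" .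
qed

lemma summable_on_product_nonneg:
  fixes u :: "'u \<Rightarrow> real" and v :: "'v \<Rightarrow> real"
  assumes "u summable_on UNIV" "v summable_on UNIV" "\<And>p. 0 \<le> u p" "\<And>q. 0 \<le> v q"
  shows "(\<lambda>(p, q). u p * v q) summable_on UNIV"
    and "(\<Sum>\<^sub>\<infinity>(p, q). u p * v q) = infsum u UNIV * infsum v UNIV"
proof -
  have "(\<lambda>(p, q). u p * v q) summable_on (UNIV \<times> UNIV)"
    by (rule summable_on_SigmaI[where g = "\<lambda>p. u p * infsum v UNIV"])
       (use assms in \<open>auto intro!: has_sum_cmult_right has_sum_infsum summable_on_cmult_left\<close>)
  then show *: "(\<lambda>(p, q). u p * v q) summable_on UNIV"
    by simp
  have "(\<Sum>\<^sub>\<infinity>(p, q). u p * v q) = (\<Sum>\<^sub>\<infinity>p. \<Sum>\<^sub>\<infinity>q. u p * v q)"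
    using infsum_Sigma'_banach[of "\<lambda>p q. u p * v q" UNIV "\<lambda>_. UNIV"] * by simp
  then show "(\<Sum>\<^sub>\<infinity>(p, q). u p * v q) = infsum u UNIV * infsum v UNIV"
    using assms by (simp add: infsum_cmult_right' infsum_cmult_left')
qed

text \<open>Injectivity makes the dominating double family a subfamily of all products u p * v q, so
  its total is at most the product of the two totals; summing along x first only groups terms.
  Convolution and the matrix products with a summable bound are all instances, with y the output
  index and x the summation index.\<close>

lemma weighted_slices:
  fixes u :: "'u \<Rightarrow> real" and v :: "'v \<Rightarrow> real" and f :: "'y \<Rightarrow> 'x \<Rightarrow> 'u" and g :: "'y \<Rightarrow> 'x \<Rightarrow> 'v"
    and \<phi> :: "'x \<Rightarrow> 'y \<Rightarrow> complex" and W :: "'y \<Rightarrow> real"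
  assumes uv: "u summable_on UNIV" "v summable_on UNIV" "\<And>p. 0 \<le> u p" "\<And>q. 0 \<le> v q"
    and inj: "inj (\<lambda>(y, x). (f y x, g y x))" and W: "\<And>y. 0 < W y"
    and le: "\<And>x y. W y * norm (\<phi> x y) \<le> u (f y x) * v (g y x)"
  shows "(\<lambda>x. \<phi> x y) summable_on UNIV"
    and "(\<lambda>y. \<Sum>\<^sub>\<infinity>x. \<phi> x y) \<in> weighted_l1 W"
    and "weighted_norm W (\<lambda>y. \<Sum>\<^sub>\<infinity>x. \<phi> x y) \<le> infsum u UNIV * infsum v UNIV"
proof -
  define \<psi> where "\<psi> y x = u (f y x) * v (g y x)" for y x
  note prod = summable_on_product_nonneg[OF uv]
  have \<psi>eq: "(\<lambda>z. case (\<lambda>(y, x). (f y x, g y x)) z of (p, q) \<Rightarrow> u p * v q) = (\<lambda>(y, x). \<psi> y x)"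
    by (auto simp: \<psi>_def fun_eq_iff case_prod_unfold)
  have sum: "(\<lambda>(y, x). \<psi> y x) summable_on UNIV \<times> UNIV"
    and bound: "(\<Sum>\<^sub>\<infinity>(y, x). \<psi> y x) \<le> infsum u UNIV * infsum v UNIV"
    using nonneg_infsum_inj[OF prod(1), of "\<lambda>(y, x). (f y x, g y x)" UNIV] uv inj
    unfolding \<psi>eq prod(2) by auto
  have \<psi>0: "0 \<le> \<psi> y x" for y x
    using uv by (simp add: \<psi>_def)
  have slice: "\<psi> y summable_on UNIV" for y
    using summable_on_SigmaD1[OF sum] \<psi>0 by fastforce
  have outer: "(\<lambda>y. infsum (\<psi> y) UNIV) summable_on UNIV"
    using summable_on_Sigma_banach[OF sum] by simp
  have wslice: "(\<lambda>x. W y * norm (\<phi> x y)) summable_on UNIV" for y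
    by (rule summable_on_comparison_test[OF slice[of y]]) (simp_all add: le \<psi>_def W less_imp_le)
  then have nslice: "(\<lambda>x. norm (\<phi> x y)) summable_on UNIV" for y
    using summable_on_cmult_right[OF wslice[of y], of "inverse (W y)"] W[of y]
    by (simp add: field_simps)
  then show "(\<lambda>x. \<phi> x y) summable_on UNIV"
    by (rule abs_summable_summable)
  have pt: "W y * norm (\<Sum>\<^sub>\<infinity>x. \<phi> x y) \<le> infsum (\<psi> y) UNIV" for y
  proof -
    have "W y * norm (\<Sum>\<^sub>\<infinity>x. \<phi> x y) \<le> W y * (\<Sum>\<^sub>\<infinity>x. norm (\<phi> x y))"
      by (intro mult_left_mono norm_infsum_bound nslice less_imp_le W)
    also have "\<dots> = (\<Sum>\<^sub>\<infinity>x. W y * norm (\<phi> x y))"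
      by (simp add: infsum_cmult_right')
    also have "\<dots> \<le> infsum (\<psi> y) UNIV"
      by (rule infsum_mono[OF wslice slice]) (use le in \<open>simp add: \<psi>_def\<close>)
    finally show ?thesis .
  qed
  have fin: "(\<lambda>y. W y * norm (\<Sum>\<^sub>\<infinity>x. \<phi> x y)) summable_on UNIV"
    by (rule summable_on_comparison_test[OF outer]) (simp_all add: pt W less_imp_le)
  then show "(\<lambda>y. \<Sum>\<^sub>\<infinity>x. \<phi> x y) \<in> weighted_l1 W"
    by (simp add: weighted_l1_def)
  have "weighted_norm W (\<lambda>y. \<Sum>\<^sub>\<infinity>x. \<phi> x y) \<le> (\<Sum>\<^sub>\<infinity>y. infsum (\<psi> y) UNIV)"
    unfolding weighted_norm_def by (rule infsum_mono[OF fin outer pt])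
  also have "\<dots> = (\<Sum>\<^sub>\<infinity>(y, x). \<psi> y x)"
    using infsum_Sigma'_banach[OF sum] by simp
  finally show "weighted_norm W (\<lambda>y. \<Sum>\<^sub>\<infinity>x. \<phi> x y) \<le> infsum u UNIV * infsum v UNIV"
    using bound by simp
qed

text \<open>The tails are estimated on finite index sets, so that no interchange of two infinite sums is needed.\<close>

lemma weighted_series:
  fixes u :: "nat \<Rightarrow> 'k \<Rightarrow> complex" and w :: "'k \<Rightarrow> real"
  assumes w: "\<And>k. 1 \<le> w k" and u: "\<And>n. u n \<in> weighted_l1 w"
    and le: "\<And>n. weighted_norm w (u n) \<le> B n" and B: "summable B"
    and v: "\<And>k. v k = (\<Sum>n. u n k)"
  shows "v \<in> weighted_l1 w"
    and "(\<lambda>N. weighted_norm w (\<lambda>k. (\<Sum>n<N. u n k) - v k)) \<longlonglongrightarrow> 0"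
    and "(\<lambda>k. (\<Sum>n<N. u n k) - v k) \<in> weighted_l1 w"
proof -
  have w0: "0 \<le> w k" for k
    using w[of k] by linarith
  have fin: "(\<Sum>k\<in>F. w k * norm (u n k)) \<le> B n" if "finite F" for F n
  proof -
    have "(\<Sum>k\<in>F. w k * norm (u n k)) \<le> weighted_norm w (u n)"
      unfolding weighted_norm_def
      by (rule finite_sum_le_infsum) (use u w0 that in \<open>auto simp: weighted_l1_def\<close>)
    then show ?thesis
      using le[of n] by simp
  qed
  have pt: "w k * norm (u n k) \<le> B n" for n k
    using fin[of "{k}" n] by simp
  \<comment> \<open>Since the weight is at least 1, the weighted bound also dominates each
    coordinate, so the series at every k converges absolutely.\<close>
  have "norm (u n k) \<le> B n" for n k
    using pt[of k n] mult_right_mono[OF w[of k], of "norm (u n k)"] by simp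
  then have nsum: "summable (\<lambda>n. norm (u n k))" for k
    by (intro summable_comparison_test'[OF B]) auto
  have sm: "summable (\<lambda>n. u n k)" for k
    by (rule summable_norm_cancel[OF nsum])
  have tail: "(\<Sum>k\<in>F. w k * norm ((\<Sum>n<N. u n k) - v k)) \<le> (\<Sum>n. B (n + N))"
    if F: "finite F" for F N
  proof -
    have nN: "summable (\<lambda>n. norm (u (n + N) k))" for k
      using nsum by (rule summable_ignore_initial_segment)
    have "w k * norm ((\<Sum>n<N. u n k) - v k) \<le> (\<Sum>n. w k * norm (u (n + N) k))" for k
    proof -
      have "norm ((\<Sum>n<N. u n k) - v k) = norm (\<Sum>n. u (n + N) k)"
        unfolding v suminf_minus_initial_segment[OF sm, of N k] by (simp add: norm_minus_commute)
      also have "\<dots> \<le> (\<Sum>n. norm (u (n + N) k))"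
        by (rule summable_norm[OF nN])
      finally show ?thesis
        using w0[of k] nN by (simp add: suminf_mult mult_left_mono)
    qed
    then have "(\<Sum>k\<in>F. w k * norm ((\<Sum>n<N. u n k) - v k)) \<le> (\<Sum>k\<in>F. \<Sum>n. w k * norm (u (n + N) k))"
      by (rule sum_mono)
    also have "\<dots> = (\<Sum>n. \<Sum>k\<in>F. w k * norm (u (n + N) k))"
      by (rule suminf_sum[symmetric]) (rule summable_mult[OF nN])
    also have "\<dots> \<le> (\<Sum>n. B (n + N))"
      by (rule suminf_le[OF fin[OF F] summable_sum[OF summable_mult[OF nN]]
            summable_ignore_initial_segment[OF B]])
    finally show ?thesis .
  qed
  have summ: "(\<lambda>k. w k * norm ((\<Sum>n<N. u n k) - v k)) summable_on UNIV" for N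
    by (rule nonneg_bdd_above_summable_on) (use tail w0 in \<open>auto intro!: bdd_aboveI2\<close>)
  then show "(\<lambda>k. (\<Sum>n<N. u n k) - v k) \<in> weighted_l1 w"
    by (simp add: weighted_l1_def)
  \<comment> \<open>For N = 0 the partial sum is empty and the difference is - v.\<close>
  show "v \<in> weighted_l1 w"
    using summ[of 0] by (simp add: weighted_l1_def)
  show "(\<lambda>N. weighted_norm w (\<lambda>k. (\<Sum>n<N. u n k) - v k)) \<longlonglongrightarrow> 0"
  proof (rule tendsto_sandwich[OF _ _ tendsto_const])
    show "\<forall>\<^sub>F N in sequentially. 0 \<le> weighted_norm w (\<lambda>k. (\<Sum>n<N. u n k) - v k)"
      using w0 by (auto simp: weighted_norm_def intro!: always_eventually infsum_nonneg)
    show "\<forall>\<^sub>F N in sequentially. weighted_norm w (\<lambda>k. (\<Sum>n<N. u n k) - v k) \<le> (\<Sum>n. B (n + N))"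
      using tail by (auto simp: weighted_norm_def intro!: always_eventually infsum_le_finite_sums summ)
    show "(\<lambda>N. \<Sum>n. B (n + N)) \<longlonglongrightarrow> 0"
      using suminf_exist_split2[OF B] .
  qed
qed

section \<open>Convolution of Laurent series\<close>

definition conv :: "laurent \<Rightarrow> laurent \<Rightarrow> laurent" where
  "conv a b n = (\<Sum>\<^sub>\<infinity>p. a p * b (n - p))"

primrec conv_pow :: "laurent \<Rightarrow> nat \<Rightarrow> laurent" where
  "conv_pow a 0 = (\<lambda>k. if k = 0 then 1 else 0)"
| "conv_pow a (Suc n) = conv a (conv_pow a n)"

text \<open>The offset 1 comes from numbering rows and columns from 0: the corner entry is the
  coefficient of index 1, and the constant coefficient does not occur.\<close>

definition hankel :: "laurent \<Rightarrow> semi_matrix" where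
  "hankel a = (\<lambda>i j. a (int i + int j + 1))"

lemma weighted_norm_nonneg: "(\<And>k. 0 \<le> w k) \<Longrightarrow> 0 \<le> weighted_norm w x"
  unfolding weighted_norm_def by (intro infsum_nonneg) simp

text \<open>Submultiplicativity distributes the weight at n over the factors at p and n - p, and the
  pair (n, p) can be recovered from (p, n - p), so \<open>weighted_slices\<close> applies.\<close>

lemma conv_weighted:
  fixes w :: "int \<Rightarrow> real"
  assumes w: "\<And>k. 0 < w k" and sub: "\<And>j k. w (j + k) \<le> w j * w k"
    and a: "a \<in> weighted_l1 w" and b: "b \<in> weighted_l1 w"
  shows "(\<lambda>p. a p * b (n - p)) summable_on UNIV"
    and "conv a b \<in> weighted_l1 w"
    and "weighted_norm w (conv a b) \<le> weighted_norm w a * weighted_norm w b"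
proof -
  note w0 = less_imp_le[OF w]
  have le: "w n * norm (a p * b (n - p))
      \<le> w p * norm (a p)
        * (w (n - p) * norm (b (n - p)))"
    for p n
    using mult_right_mono[OF sub[of p "n - p"], of "norm (a p) * norm (b (n - p))"]
    by (simp add: norm_mult mult_ac)
  have inj: "inj (\<lambda>(n, p). (p, n - p :: int))"
    by (auto simp: inj_def)
  have nn: "0 \<le> w p * norm (x p)" for x :: laurent and p
    using w0 by simp
  note * = weighted_slices[where u = "\<lambda>p. w p * norm (a p)" and v = "\<lambda>p. w p * norm (b p)"
      and f = "\<lambda>n p. p" and g = "\<lambda>n p. n - p" and W = w and \<phi> = "\<lambda>p n. a p * b (n - p)",
      OF _ _ nn[where x = a] nn[where x = b] inj w le, folded weighted_norm_def conv_def]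
  show "(\<lambda>p. a p * b (n - p)) summable_on UNIV"
    by (rule *(1)) (use a b in \<open>simp_all add: weighted_l1_def\<close>)
  show "conv a b \<in> weighted_l1 w"
    by (rule *(2)) (use a b in \<open>simp_all add: weighted_l1_def\<close>)
  show "weighted_norm w (conv a b) \<le> weighted_norm w a * weighted_norm w b"
    by (rule *(3)) (use a b in \<open>simp_all add: weighted_l1_def\<close>)
qed

lemma weighted_single:
  "(\<lambda>k. if k = k0 then x else 0) \<in> weighted_l1 w"
  "weighted_norm w (\<lambda>k. if k = k0 then x else 0) = w k0 * norm x"
proof -
  have "((\<lambda>k. w k * norm (if k = k0 then x else 0)) has_sum (w k0 * norm x)) UNIV"
    by (rule has_sum_finite_neutralI[of "{k0}"]) auto
  then show "(\<lambda>k. if k = k0 then x else 0) \<in> weighted_l1 w"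
    "weighted_norm w (\<lambda>k. if k = k0 then x else 0) = w k0 * norm x"
    by (auto simp: weighted_l1_def weighted_norm_def summable_on_def infsumI)
qed

lemma conv_pow_weighted:
  fixes w :: "int \<Rightarrow> real"
  assumes w: "\<And>k. 0 < w k" and sub: "\<And>j k. w (j + k) \<le> w j * w k" and w0: "w 0 = 1"
    and a: "a \<in> weighted_l1 w"
  shows "conv_pow a n \<in> weighted_l1 w \<and> weighted_norm w (conv_pow a n) \<le> weighted_norm w a ^ n"
proof (induction n)
  case 0
  show ?case
    by (simp add: weighted_single w0)
next
  case (Suc n)
  have "weighted_norm w (conv a (conv_pow a n)) \<le> weighted_norm w a * weighted_norm w (conv_pow a n)"
    by (rule conv_weighted(3)[OF w sub a conjunct1[OF Suc]])
  also have "\<dots> \<le> weighted_norm w a * weighted_norm w a ^ n"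
    using Suc w by (intro mult_left_mono weighted_norm_nonneg) (auto simp: less_imp_le)
  finally show ?case
    using conv_weighted(2)[OF w sub a] Suc by simp
qed

text \<open>This is the Cauchy product: absolute convergence of the double family permits summing it
  along n = p + q or along p and q separately.\<close>

lemma laurent_eval_conv:
  assumes a: "(\<lambda>k. a k * z powi k) summable_on UNIV" and b: "(\<lambda>k. b k * z powi k) summable_on UNIV"
    and z: "z \<noteq> 0"
  shows "laurent_eval (conv a b) z = laurent_eval a z * laurent_eval b z"
proof -
  define \<phi> where "\<phi> = (\<lambda>p q. (a p * z powi p) * (b q * z powi q))"
  \<comment> \<open>Unordered summability of a complex family is the same as absolute summability,
    so the pointwise hypotheses suffice.\<close>
  have "(\<lambda>p. norm (a p * z powi p)) summable_on UNIV" "(\<lambda>p. norm (b p * z powi p)) summable_on UNIV"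
    by (rule iffD1[OF summable_on_iff_abs_summable_on_complex], fact)+
  from summable_on_product_nonneg(1)[OF this]
  have "(\<lambda>x. norm ((\<lambda>(p, q). \<phi> p q) x)) summable_on UNIV"
    by (simp add: \<phi>_def norm_mult case_prod_unfold)
  then have sum: "(\<lambda>(p, q). \<phi> p q) summable_on UNIV"
    by (rule abs_summable_summable)
  have bij: "bij_betw (\<lambda>(p, n). (p, n - p :: int)) UNIV UNIV"
    by (rule bij_betwI[where g = "\<lambda>(p, q). (p, q + p)"]) auto
  have sum': "(\<lambda>(p, n). \<phi> p (n - p)) summable_on UNIV \<times> UNIV"
    using summable_on_reindex_bij_betw[OF bij, of "\<lambda>(p, q). \<phi> p q"] sum
    by (simp add: case_prod_unfold)
  have conv: "conv a b n * z powi n = (\<Sum>\<^sub>\<infinity>p. \<phi> p (n - p))" for n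
  proof -
    have "\<phi> p (n - p) = a p * b (n - p) * z powi n" for p
      using z power_int_add[of z p "n - p"] by (simp add: \<phi>_def)
    then show ?thesis
      by (simp add: conv_def infsum_cmult_left')
  qed
  have "laurent_eval (conv a b) z = (\<Sum>\<^sub>\<infinity>n. \<Sum>\<^sub>\<infinity>p. \<phi> p (n - p))"
    by (simp add: laurent_eval_def conv)
  also have "\<dots> = (\<Sum>\<^sub>\<infinity>p. \<Sum>\<^sub>\<infinity>n. \<phi> p (n - p))"
    by (rule infsum_swap_banach[symmetric, OF sum'])
  also have "\<dots> = (\<Sum>\<^sub>\<infinity>p. \<Sum>\<^sub>\<infinity>q. \<phi> p q)"
  proof (rule infsum_cong)
    fix p :: int
    show "(\<Sum>\<^sub>\<infinity>n. \<phi> p (n - p)) = (\<Sum>\<^sub>\<infinity>q. \<phi> p q)"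
      by (rule infsum_reindex_bij_betw) (rule bij_betwI[where g = "\<lambda>q. q + p"]; auto)
  qed
  also have "\<dots> = laurent_eval a z * laurent_eval b z"
    by (simp add: \<phi>_def laurent_eval_def infsum_cmult_right' infsum_cmult_left')
  finally show ?thesis .
qed

section \<open>Products of quasi-Toeplitz matrices\<close>

lemma weighted_add:
  assumes w: "\<And>k. 0 \<le> w k" and x: "x \<in> weighted_l1 w" and y: "y \<in> weighted_l1 w"
  shows "x + y \<in> weighted_l1 w" "weighted_norm w (x + y) \<le> weighted_norm w x + weighted_norm w y"
proof -
  have sum: "(\<lambda>k. w k * norm (x k) + w k * norm (y k)) summable_on UNIV"
    using x y by (intro summable_on_add) (simp_all add: weighted_l1_def)
  have le: "w k * norm ((x + y) k) \<le> w k * norm (x k) + w k * norm (y k)" for k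
    using mult_left_mono[OF norm_triangle_ineq[of "x k" "y k"] w[of k]] by (simp add: algebra_simps)
  have sum': "(\<lambda>k. w k * norm ((x + y) k)) summable_on UNIV"
    by (rule summable_on_comparison_test[OF sum le]) (simp add: w)
  then show "x + y \<in> weighted_l1 w"
    by (simp add: weighted_l1_def)
  have "weighted_norm w (x + y) \<le> (\<Sum>\<^sub>\<infinity>k. w k * norm (x k) + w k * norm (y k))"
    unfolding weighted_norm_def by (rule infsum_mono[OF sum' sum le])
  then show "weighted_norm w (x + y) \<le> weighted_norm w x + weighted_norm w y"
    using x y by (simp add: infsum_add weighted_norm_def weighted_l1_def)
qed

lemma weighted_scale:
  assumes x: "x \<in> weighted_l1 w"
  shows "(\<lambda>k. c * x k) \<in> weighted_l1 w" "weighted_norm w (\<lambda>k. c * x k) = norm c * weighted_norm w x"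
  using x summable_on_cmult_right[of "\<lambda>k. w k * norm (x k)" UNIV "norm c"]
  by (simp_all add: weighted_l1_def weighted_norm_def norm_mult mult.left_commute infsum_cmult_right')

lemma wiener_iff: "a \<in> wiener \<longleftrightarrow> a \<in> weighted_l1 (\<lambda>_. 1)"
  by (simp add: wiener_def weighted_l1_def)

lemma wiener_norm_eq: "wiener_norm a = weighted_norm (\<lambda>_. 1) a"
  by (simp add: wiener_norm_def weighted_norm_def)

lemma Fmat_iff: "E \<in> Fmat \<longleftrightarrow> (\<lambda>(i, j). E i j) \<in> weighted_l1 (\<lambda>_. 1)"
  by (simp add: Fmat_def weighted_l1_def case_prod_unfold)

lemma Fmat_norm_eq: "Fmat_norm E = weighted_norm (\<lambda>_. 1) (\<lambda>(i, j). E i j)"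
  by (simp add: Fmat_norm_def weighted_norm_def case_prod_unfold)

lemma Fmat_norm_nonneg: "0 \<le> Fmat_norm E"
  by (simp add: Fmat_norm_eq weighted_norm_nonneg)

lemma wiener_norm_nonneg: "0 \<le> wiener_norm a"
  by (simp add: wiener_norm_eq weighted_norm_nonneg)

lemma Fmat_add:
  assumes "E \<in> Fmat" "F \<in> Fmat"
  shows "E + F \<in> Fmat" "Fmat_norm (E + F) \<le> Fmat_norm E + Fmat_norm F"
proof -
  have "(\<lambda>(i, j). (E + F) i j) = (\<lambda>(i, j). E i j) + (\<lambda>(i, j). F i j)"
    by auto
  then show "E + F \<in> Fmat" "Fmat_norm (E + F) \<le> Fmat_norm E + Fmat_norm F"
    using weighted_add[of "\<lambda>_. 1" "\<lambda>(i, j). E i j" "\<lambda>(i, j). F i j"] assms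
    by (simp_all add: Fmat_iff Fmat_norm_eq)
qed

lemma Fmat_uminus: "Fmat_norm (- E) = Fmat_norm E" "- E \<in> Fmat \<longleftrightarrow> E \<in> Fmat"
  by (simp_all add: Fmat_norm_def Fmat_def)

lemma Fmat_mat_scale:
  assumes "E \<in> Fmat"
  shows "mat_scale c E \<in> Fmat" "Fmat_norm (mat_scale c E) = norm c * Fmat_norm E"
  using weighted_scale[of "\<lambda>(i, j). E i j" "\<lambda>_. 1" c] assms
  by (simp_all add: Fmat_iff Fmat_norm_eq mat_scale_def case_prod_unfold)

text \<open>Here the output index is the entry (i, j) and the weight is 1. The three products below
  differ only in which data of the two factors determine i, j and k.\<close>

lemma mat_mult_Fmat:
  fixes u :: "'u \<Rightarrow> real" and v :: "'v \<Rightarrow> real"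
    and f :: "nat \<times> nat \<Rightarrow> nat \<Rightarrow> 'u" and g :: "nat \<times> nat \<Rightarrow> nat \<Rightarrow> 'v"
  assumes uv: "u summable_on UNIV" "v summable_on UNIV" "\<And>p. 0 \<le> u p" "\<And>q. 0 \<le> v q"
    and inj: "inj (\<lambda>(y, k). (f y k, g y k))"
    and le: "\<And>i j k. norm (A i k * B k j) \<le> u (f (i, j) k) * v (g (i, j) k)"
  shows "(\<lambda>k. A i k * B k j) summable_on UNIV"
    and "mat_mult A B \<in> Fmat"
    and "Fmat_norm (mat_mult A B) \<le> infsum u UNIV * infsum v UNIV"
proof -
  have le': "1 * norm (A (fst y) k * B k (snd y)) \<le> u (f y k) * v (g y k)" for y k
    using le[of "fst y" k "snd y"] by simp
  note * = weighted_slices[where W = "\<lambda>_. 1", OF uv inj zero_less_one le']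
  show "(\<lambda>k. A i k * B k j) summable_on UNIV"
    using *(1)[of "(i, j)"] by simp
  show "mat_mult A B \<in> Fmat" "Fmat_norm (mat_mult A B) \<le> infsum u UNIV * infsum v UNIV"
    using *(2,3) by (simp_all add: Fmat_iff Fmat_norm_eq mat_mult_def case_prod_unfold)
qed

lemma mat_mult_Fmat_Fmat:
  assumes "E \<in> Fmat" "F \<in> Fmat"
  shows "(\<lambda>k. E i k * F k j) summable_on UNIV"
    and "mat_mult E F \<in> Fmat"
    and "Fmat_norm (mat_mult E F) \<le> Fmat_norm E * Fmat_norm F"
proof -
  have inj: "inj (\<lambda>(y :: nat \<times> nat, k :: nat). ((fst y, k), (k, snd y)))"
    by (auto simp: inj_def)
  note * = mat_mult_Fmat[where u = "\<lambda>(i, j). norm (E i j)" and v = "\<lambda>(i, j). norm (F i j)"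
      and A = E and B = F, OF _ _ _ _ inj, folded Fmat_norm_def]
  show "(\<lambda>k. E i k * F k j) summable_on UNIV"
    by (rule *(1)) (use assms in \<open>auto simp: Fmat_def norm_mult\<close>)
  show "mat_mult E F \<in> Fmat"
    by (rule *(2)) (use assms in \<open>auto simp: Fmat_def norm_mult\<close>)
  show "Fmat_norm (mat_mult E F) \<le> Fmat_norm E * Fmat_norm F"
    by (rule *(3)) (use assms in \<open>auto simp: Fmat_def norm_mult\<close>)
qed

text \<open>The diagonal k - i together with the entry (k, j) determines i, j and k, so each
  coefficient of a meets each entry of F at most once. This is why the Wiener norm bounds the
  Toeplitz factor although its entries are not summable in general.\<close>

lemma mat_mult_toeplitz_Fmat:
  assumes "a \<in> wiener" "F \<in> Fmat"
  shows "(\<lambda>k. toeplitz a i k * F k j) summable_on UNIV"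
    and "mat_mult (toeplitz a) F \<in> Fmat"
    and "Fmat_norm (mat_mult (toeplitz a) F) \<le> wiener_norm a * Fmat_norm F"
proof -
  have inj: "inj (\<lambda>(y :: nat \<times> nat, k :: nat). (int k - int (fst y), (k, snd y)))"
    by (auto simp: inj_def)
  note * = mat_mult_Fmat[where u = "\<lambda>k. norm (a k)" and v = "\<lambda>(i, j). norm (F i j)"
      and A = "toeplitz a" and B = F, OF _ _ _ _ inj, folded Fmat_norm_def wiener_norm_def]
  show "(\<lambda>k. toeplitz a i k * F k j) summable_on UNIV"
    by (rule *(1)) (use assms in \<open>auto simp: Fmat_def wiener_def toeplitz_def norm_mult\<close>)
  show "mat_mult (toeplitz a) F \<in> Fmat"
    by (rule *(2)) (use assms in \<open>auto simp: Fmat_def wiener_def toeplitz_def norm_mult\<close>)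
  show "Fmat_norm (mat_mult (toeplitz a) F) \<le> wiener_norm a * Fmat_norm F"
    by (rule *(3)) (use assms in \<open>auto simp: Fmat_def wiener_def toeplitz_def norm_mult\<close>)
qed

lemma mat_mult_Fmat_toeplitz:
  assumes "E \<in> Fmat" "b \<in> wiener"
  shows "(\<lambda>k. E i k * toeplitz b k j) summable_on UNIV"
    and "mat_mult E (toeplitz b) \<in> Fmat"
    and "Fmat_norm (mat_mult E (toeplitz b)) \<le> Fmat_norm E * wiener_norm b"
proof -
  have inj: "inj (\<lambda>(y :: nat \<times> nat, k :: nat). ((fst y, k), int (snd y) - int k))"
    by (auto simp: inj_def)
  note * = mat_mult_Fmat[where u = "\<lambda>(i, j). norm (E i j)" and v = "\<lambda>k. norm (b k)"
      and A = E and B = "toeplitz b", OF _ _ _ _ inj, folded Fmat_norm_def wiener_norm_def]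
  show "(\<lambda>k. E i k * toeplitz b k j) summable_on UNIV"
    by (rule *(1)) (use assms in \<open>auto simp: Fmat_def wiener_def toeplitz_def norm_mult\<close>)
  show "mat_mult E (toeplitz b) \<in> Fmat"
    by (rule *(2)) (use assms in \<open>auto simp: Fmat_def wiener_def toeplitz_def norm_mult\<close>)
  show "Fmat_norm (mat_mult E (toeplitz b)) \<le> Fmat_norm E * wiener_norm b"
    by (rule *(3)) (use assms in \<open>auto simp: Fmat_def wiener_def toeplitz_def norm_mult\<close>)
qed

text \<open>
  A coefficient \<open>a\<^sub>n\<close> occurs \<open>|n|\<close> times in a Hankel matrix, which is where the derivative
  of the symbol comes in. The sign \<open>\<epsilon>\<close> selects the coefficients of positive or negative index.
\<close>

lemma Fmat_hankel:
  fixes \<epsilon> :: int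
  assumes a: "laurent_deriv a \<in> wiener" and \<epsilon>: "\<bar>\<epsilon>\<bar> = 1"
  shows "hankel (\<lambda>k. a (\<epsilon> * k)) \<in> Fmat"
    and "Fmat_norm (hankel (\<lambda>k. a (\<epsilon> * k))) \<le> wiener_norm (laurent_deriv a)"
proof -
  \<comment> \<open>The derivative has (k + 1) a_(k+1) as its coefficient of index k. Its modulus is
    spread over |k + 1| copies of |a_(k+1)|, which turns the norm of the derivative into a sum over
    T.\<close>
  define T :: "(int \<times> nat) set" where "T = Sigma UNIV (\<lambda>k. {..<nat \<bar>k + 1\<bar>})"
  define f where "f = (\<lambda>(k, i :: nat). norm (a (k + 1)))"
  have slice: "((\<lambda>i. f (k, i)) has_sum norm (laurent_deriv a k)) {..<nat \<bar>k + 1\<bar>}" for k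
    using has_sum_finite[of "{..<nat \<bar>k + 1\<bar>}" "\<lambda>i. f (k, i)"]
    by (simp add: f_def laurent_deriv_def norm_mult norm_of_int del: of_int_add)
  have f: "f summable_on T"
    unfolding T_def using a
    by (intro summable_on_SigmaI[where g = "\<lambda>k. norm (laurent_deriv a k)"] slice)
       (simp_all add: wiener_def f_def)
  have norm: "infsum f T = wiener_norm (laurent_deriv a)"
    using infsum_Sigma_banach[OF f[unfolded T_def]] infsumI[OF slice]
    by (simp add: T_def wiener_norm_def)
  \<comment> \<open>An entry goes to its coefficient, with the index shift of
    \<open>laurent_deriv\<close> undone, and to its row. The row i is below i + j + 1, which is |k +
    1| at k = \<epsilon> (i + j + 1) - 1, so the image lies in T.\<close>
  define h where "h = (\<lambda>(i, j). (\<epsilon> * (int i + int j + 1) - 1, i))"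
  have "\<epsilon> = 1 \<or> \<epsilon> = - 1"
    using \<epsilon> by auto
  then have "inj h" "range h \<subseteq> T"
    by (auto simp: h_def T_def inj_def)
  moreover have "f (h (i, j)) = norm (hankel (\<lambda>k. a (\<epsilon> * k)) i j)" for i j
    by (simp add: f_def h_def hankel_def)
  then have "(\<lambda>x. f (h x)) = (\<lambda>(i, j). norm (hankel (\<lambda>k. a (\<epsilon> * k)) i j))"
    by auto
  moreover have "0 \<le> f y" for y
    by (simp add: f_def case_prod_unfold)
  ultimately show "hankel (\<lambda>k. a (\<epsilon> * k)) \<in> Fmat"
    "Fmat_norm (hankel (\<lambda>k. a (\<epsilon> * k))) \<le> wiener_norm (laurent_deriv a)"
    using nonneg_infsum_inj[OF f, of h UNIV] norm by (simp_all add: Fmat_def Fmat_norm_def)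
qed

section \<open>Products of symbols and of Toeplitz matrices\<close>

lemma conv_wiener:
  assumes "a \<in> wiener" "b \<in> wiener"
  shows "(\<lambda>p. a p * b (n - p)) summable_on UNIV"
    and "conv a b \<in> wiener"
    and "wiener_norm (conv a b) \<le> wiener_norm a * wiener_norm b"
  using conv_weighted[of "\<lambda>_. 1" a b] assms by (simp_all add: wiener_iff wiener_norm_eq)

text \<open>The Leibniz rule, from splitting the factor k + 1 as p + (k + 1 - p) in each term of the
  convolution. Summability of the two resulting families is what membership in
  \<open>wiener1\<close> provides.\<close>

lemma laurent_deriv_conv:
  assumes "a \<in> wiener1" "b \<in> wiener1"
  shows "laurent_deriv (conv a b) = conv (laurent_deriv a) b + conv a (laurent_deriv b)"
proof
  fix k :: int
  note ab = assms[unfolded wiener1_def]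
  let ?x = "\<lambda>p. of_int p * a p * b (k + 1 - p)"
  let ?y = "\<lambda>p. a p * laurent_deriv b (k - p)"
  have bij: "bij_betw (\<lambda>q. q + 1 :: int) UNIV UNIV"
    by (rule bij_betwI[where g = "\<lambda>q. q - 1"]) auto
  have x: "?x summable_on UNIV"
    using summable_on_reindex_bij_betw[OF bij, of ?x] conv_wiener(1)[of "laurent_deriv a" b k] ab
    by (simp add: laurent_deriv_def algebra_simps)
  have xs: "infsum ?x UNIV = conv (laurent_deriv a) b k"
    using infsum_reindex_bij_betw[OF bij, of ?x]
    by (simp add: conv_def laurent_deriv_def algebra_simps)
  have "laurent_deriv (conv a b) k = (\<Sum>\<^sub>\<infinity>p. of_int (k + 1) * (a p * b (k + 1 - p)))"
    by (simp add: laurent_deriv_def conv_def infsum_cmult_right')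
  also have "\<dots> = (\<Sum>\<^sub>\<infinity>p. ?x p + ?y p)"
    by (rule infsum_cong) (simp add: laurent_deriv_def algebra_simps)
  also have "\<dots> = infsum ?x UNIV + infsum ?y UNIV"
    using ab by (intro infsum_add x conv_wiener(1)) simp_all
  also have "\<dots> = (conv (laurent_deriv a) b + conv a (laurent_deriv b)) k"
    by (simp add: xs) (simp add: conv_def)
  finally show "laurent_deriv (conv a b) k = (conv (laurent_deriv a) b + conv a (laurent_deriv b)) k" .
qed

text \<open>
  Submultiplicativity of the weight \<open>1 + |k|\<close> would only give this bound with the extra term
  \<open>\<parallel>a'\<parallel> \<parallel>b'\<parallel>\<close>, which has to be kept for the Hankel product.
\<close>

lemma conv_wiener1:
  assumes "a \<in> wiener1" "b \<in> wiener1"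
  shows "conv a b \<in> wiener1"
    and "wiener_norm (laurent_deriv (conv a b))
      \<le> wiener_norm (laurent_deriv a) * wiener_norm b + wiener_norm a * wiener_norm (laurent_deriv b)"
proof -
  note ab = assms[unfolded wiener1_def, simplified]
  note c = conv_wiener[of "laurent_deriv a" b] conv_wiener[of a "laurent_deriv b"]
  note * = weighted_add[of "\<lambda>_. 1" "conv (laurent_deriv a) b" "conv a (laurent_deriv b)",
      folded wiener_iff wiener_norm_eq laurent_deriv_conv[OF assms]]
  show "conv a b \<in> wiener1"
    using ab c * conv_wiener(2)[of a b] by (simp add: wiener1_def)
  show "wiener_norm (laurent_deriv (conv a b))
      \<le> wiener_norm (laurent_deriv a) * wiener_norm b + wiener_norm a * wiener_norm (laurent_deriv b)"
    using ab c * by fastforce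
qed

text \<open>The coefficient of the product symbol sums over all integers p, whereas the matrix
  product reaches only p = k - i with k at least 0. The omitted indices p = - i - k - 1 make up
  exactly the entry of the Hankel product.\<close>

lemma mat_mult_toeplitz:
  assumes a: "a \<in> wiener" and b: "b \<in> wiener"
  shows "(\<lambda>k. toeplitz a i k * toeplitz b k j) summable_on UNIV"
    and "mat_mult (toeplitz a) (toeplitz b) i j
      = toeplitz (conv a b) i j - mat_mult (hankel (\<lambda>k. a (- k))) (hankel b) i j"
proof -
  let ?n = "int j - int i"
  let ?x = "\<lambda>p. a p * b (?n - p)"
  let ?f = "\<lambda>k. int k - int i"
  let ?g = "\<lambda>k. - int i - int k - 1"
  have sum: "?x summable_on UNIV"
    by (rule conv_wiener(1)[OF a b])
  have inj: "inj ?f" "inj ?g"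
    by (auto simp: inj_def)
  have disj: "range ?f \<inter> range ?g = {}"
    by auto
  have cover: "range ?f \<union> range ?g = UNIV"
  proof (rule UNIV_eq_I[symmetric])
    fix p
    show "p \<in> range ?f \<union> range ?g"
    proof (cases "p + int i \<ge> 0")
      case True
      then have "p = ?f (nat (p + int i))"
        by simp
      then show ?thesis
        by blast
    next
      case False
      then have "p = ?g (nat (- p - int i - 1))"
        by simp
      then show ?thesis
        by blast
    qed
  qed
  have sums: "?x summable_on range ?f" "?x summable_on range ?g"
    using sum summable_on_subset_banach by blast+
  have f: "(?x \<circ> ?f) = (\<lambda>k. toeplitz a i k * toeplitz b k j)"
    by (auto simp: toeplitz_def)
  have g: "(?x \<circ> ?g) = (\<lambda>k. hankel (\<lambda>k. a (- k)) i k * hankel b k j)"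
  proof
    fix k
    have "?g k = - (int i + int k + 1)" "?n - ?g k = int k + int j + 1"
      by simp_all
    then show "(?x \<circ> ?g) k = hankel (\<lambda>k. a (- k)) i k * hankel b k j"
      by (simp only: o_def hankel_def)
  qed
  show "(\<lambda>k. toeplitz a i k * toeplitz b k j) summable_on UNIV"
    using sums(1) summable_on_reindex[OF inj(1), of ?x] f by simp
  have "toeplitz (conv a b) i j = infsum ?x (range ?f \<union> range ?g)"
    by (simp add: cover toeplitz_def conv_def)
  also have "\<dots> = infsum ?x (range ?f) + infsum ?x (range ?g)"
    by (rule infsum_Un_disjoint[OF sums disj])
  also have "\<dots> = mat_mult (toeplitz a) (toeplitz b) i j + mat_mult (hankel (\<lambda>k. a (- k))) (hankel b) i j"
    unfolding infsum_reindex[OF inj(1)] infsum_reindex[OF inj(2)] f g by (simp add: mat_mult_def)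
  finally show "mat_mult (toeplitz a) (toeplitz b) i j
      = toeplitz (conv a b) i j - mat_mult (hankel (\<lambda>k. a (- k))) (hankel b) i j"
    by simp
qed

text \<open>The correction G collects the three products with a factor in \<open>Fmat\<close> and
  the negative of the Hankel product. Each bound so obtained is a separate term in the expansion of
  the product of the two norms.\<close>

lemma cqt_mult:
  assumes a: "a \<in> wiener1" and E: "E \<in> Fmat" and b: "b \<in> wiener1" and F: "F \<in> Fmat"
  defines "G \<equiv> mat_mult (toeplitz a + E) (toeplitz b + F) - toeplitz (conv a b)"
  shows "G \<in> Fmat"
    and "cqt_norm (mat_mult (toeplitz a + E) (toeplitz b + F))
      \<le> cqt_norm (toeplitz a + E) * cqt_norm (toeplitz b + F)"
proof -
  let ?H = "hankel (\<lambda>k. a (- k))"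
  have ab: "a \<in> wiener" "laurent_deriv a \<in> wiener" "b \<in> wiener" "laurent_deriv b \<in> wiener"
    using a b by (simp_all add: wiener1_def)
  have H: "?H \<in> Fmat" "Fmat_norm ?H \<le> wiener_norm (laurent_deriv a)"
    using Fmat_hankel[OF ab(2), of "- 1"] by simp_all
  have K: "hankel b \<in> Fmat" "Fmat_norm (hankel b) \<le> wiener_norm (laurent_deriv b)"
    using Fmat_hankel[OF ab(4), of 1] by simp_all
  note HK = mat_mult_Fmat_Fmat(2,3)[OF H(1) K(1)]
  note aF = mat_mult_toeplitz_Fmat[OF ab(1) F]
  note Eb = mat_mult_Fmat_toeplitz[OF E ab(3)]
  note EF = mat_mult_Fmat_Fmat[OF E F]
  have "mat_mult (toeplitz a + E) (toeplitz b + F) i j = mat_mult (toeplitz a) (toeplitz b) i j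
      + mat_mult (toeplitz a) F i j + mat_mult E (toeplitz b) i j + mat_mult E F i j" for i j
    unfolding mat_mult_def plus_fun_def
    using infsum_add[OF summable_on_add[OF summable_on_add[OF mat_mult_toeplitz(1)[OF ab(1,3)] aF(1)] Eb(1)] EF(1)]
      infsum_add[OF summable_on_add[OF mat_mult_toeplitz(1)[OF ab(1,3)] aF(1)] Eb(1)]
      infsum_add[OF mat_mult_toeplitz(1)[OF ab(1,3)] aF(1)]
    by (simp add: algebra_simps)
  then have G: "G = mat_mult (toeplitz a) F + mat_mult E (toeplitz b) + mat_mult E F + - mat_mult ?H (hankel b)"
    by (simp add: G_def fun_eq_iff mat_mult_toeplitz(2)[OF ab(1,3)])
  note add = Fmat_add[OF Fmat_add(1)[OF Fmat_add(1)[OF aF(2) Eb(2)] EF(2)] iffD2[OF Fmat_uminus(2) HK(1)]]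
    Fmat_add[OF Fmat_add(1)[OF aF(2) Eb(2)] EF(2)] Fmat_add[OF aF(2) Eb(2)]
  show GF: "G \<in> Fmat"
    unfolding G by (rule add(1))
  have HK': "Fmat_norm (mat_mult ?H (hankel b)) \<le> wiener_norm (laurent_deriv a) * wiener_norm (laurent_deriv b)"
    by (rule order_trans[OF HK(2) mult_mono]) (simp_all add: H K Fmat_norm_nonneg wiener_norm_nonneg)
  have Gle: "Fmat_norm G \<le> wiener_norm a * Fmat_norm F + Fmat_norm E * wiener_norm b
      + Fmat_norm E * Fmat_norm F + wiener_norm (laurent_deriv a) * wiener_norm (laurent_deriv b)"
    unfolding G using add(2,4,6) aF(3) Eb(3) EF(3) HK' by (simp add: Fmat_uminus)
  have eq: "mat_mult (toeplitz a + E) (toeplitz b + F) = toeplitz (conv a b) + G"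
    by (simp add: G_def)
  \<comment> \<open>Of the nine terms in the expanded product of norms, seven are used up by the
    estimates; these are the two left over.\<close>
  have "0 \<le> wiener_norm (laurent_deriv a) * Fmat_norm F" "0 \<le> Fmat_norm E * wiener_norm (laurent_deriv b)"
    by (simp_all add: Fmat_norm_nonneg wiener_norm_nonneg)
  then show "cqt_norm (mat_mult (toeplitz a + E) (toeplitz b + F))
      \<le> cqt_norm (toeplitz a + E) * cqt_norm (toeplitz b + F)"
    unfolding eq cqt_norm_eq[OF conv_wiener1(1)[OF a b] GF] cqt_norm_eq[OF a E] cqt_norm_eq[OF b F]
    using Gle conv_wiener1(2)[OF a b] conv_wiener(3)[OF ab(1,3)] by (simp add: algebra_simps)
qed

lemma cqt_pow:
  assumes a: "a \<in> wiener1" and E: "E \<in> Fmat"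
  defines "A \<equiv> toeplitz a + E"
  shows "conv_pow a n \<in> wiener1 \<and> mat_pow A n - toeplitz (conv_pow a n) \<in> Fmat
    \<and> cqt_norm (mat_pow A n) \<le> cqt_norm A ^ n"
proof (induction n)
  case 0
  have d: "laurent_deriv (conv_pow a 0) = (\<lambda>_. 0)"
  proof
    fix k :: int
    show "laurent_deriv (conv_pow a 0) k = 0"
      \<comment> \<open>At k = -1 the derivative factor vanishes; at every other index the
        coefficient of the unit does. Hence the identity matrix has norm 1.\<close>
      by (cases "k + 1 = 0") (simp_all only: laurent_deriv_def conv_pow.simps of_int_0 if_False mult_zero_left mult_zero_right)
  qed
  have e: "conv_pow a 0 \<in> wiener1"
    unfolding wiener1_def mem_Collect_eq d by (simp add: wiener_iff weighted_single) (simp add: weighted_l1_def)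
  have z: "(0 :: semi_matrix) \<in> Fmat" "Fmat_norm 0 = 0" "(\<lambda>_ _. 0) \<in> Fmat"
    by (simp_all add: Fmat_def Fmat_norm_def case_prod_unfold)
  have id: "mat_pow A 0 = toeplitz (conv_pow a 0) + 0"
    by (auto simp: mat_id_def toeplitz_def fun_eq_iff)
  show ?case
    using e z cqt_norm_eq[OF e z(1)] unfolding d id
    by (simp add: wiener_norm_eq weighted_single) (simp add: weighted_norm_def)
next
  case (Suc n)
  have nonneg: "0 \<le> cqt_norm A"
    by (simp add: A_def cqt_norm_eq[OF a E] wiener_norm_nonneg Fmat_norm_nonneg)
  define F where "F = mat_pow A n - toeplitz (conv_pow a n)"
  have F: "mat_pow A n = toeplitz (conv_pow a n) + F"
    by (simp add: F_def)
  have IH: "conv_pow a n \<in> wiener1" "F \<in> Fmat" "cqt_norm (mat_pow A n) \<le> cqt_norm A ^ n"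
    using Suc unfolding F_def by blast+
  note * = cqt_mult[OF a E IH(1,2), folded A_def F]
  have "cqt_norm A * cqt_norm (mat_pow A n) \<le> cqt_norm A ^ Suc n"
    using mult_left_mono[OF IH(3) nonneg] by simp
  then show ?case
    unfolding conv_pow.simps mat_pow.simps
    using conv_wiener1(1)[OF a IH(1)] *(1) order_trans[OF *(2)] by blast
qed

section \<open>Power series of quasi-Toeplitz matrices\<close>

lemma sum_fun_apply: "(\<Sum>i\<in>I. f i) x = (\<Sum>i\<in>I. f i x)"
  by (induction I rule: infinite_finite_induct) auto

text \<open>Up to a shift of the index, the coefficients of the derivative have moduli |k| |a_k|.
  Merging both parts of the symbol norm into one weighted norm makes \<open>weighted_series\<close>
  available for symbols.\<close>

lemma wiener1_iff: "a \<in> wiener1 \<longleftrightarrow> a \<in> weighted_l1 (\<lambda>k. 1 + \<bar>of_int k\<bar>)" (is ?iff)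
  and wiener1_norm_eq: "a \<in> wiener1 \<Longrightarrow>
    wiener_norm a + wiener_norm (laurent_deriv a) = weighted_norm (\<lambda>k. 1 + \<bar>of_int k\<bar>) a" (is "_ \<Longrightarrow> ?eq")
proof -
  let ?d = "\<lambda>k. \<bar>of_int k\<bar> * norm (a k)"
  have bij: "bij_betw (\<lambda>q. q + 1 :: int) UNIV UNIV"
    by (rule bij_betwI[where g = "\<lambda>q. q - 1"]) auto
  have d: "norm (laurent_deriv a k) = ?d (k + 1)" for k
    by (simp add: laurent_deriv_def norm_mult norm_of_int del: of_int_add)
  have wd: "laurent_deriv a \<in> wiener \<longleftrightarrow> ?d summable_on UNIV"
    using summable_on_reindex_bij_betw[OF bij, of ?d] by (simp only: wiener_def mem_Collect_eq d)
  have eq: "?d k + norm (a k) = (1 + \<bar>of_int k\<bar>) * norm (a k)" for k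
    by (simp add: algebra_simps)
  show ?iff
  proof
    assume "a \<in> wiener1"
    then have "(\<lambda>k. ?d k + norm (a k)) summable_on UNIV"
      using wd by (intro summable_on_add) (simp_all add: wiener1_def wiener_def)
    then show "a \<in> weighted_l1 (\<lambda>k. 1 + \<bar>of_int k\<bar>)"
      by (simp only: eq weighted_l1_def mem_Collect_eq)
  next
    assume a: "a \<in> weighted_l1 (\<lambda>k. 1 + \<bar>of_int k\<bar>)"
    have "?d summable_on UNIV" "(\<lambda>k. norm (a k)) summable_on UNIV"
      by (rule summable_on_comparison_test[OF a[unfolded weighted_l1_def mem_Collect_eq]];
          simp add: algebra_simps)+
    then show "a \<in> wiener1"
      using wd by (simp add: wiener1_def wiener_def)
  qed
  assume "a \<in> wiener1"
  then have "(\<Sum>\<^sub>\<infinity>k. ?d k + norm (a k)) = infsum ?d UNIV + (\<Sum>\<^sub>\<infinity>k. norm (a k))"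
    using wd by (intro infsum_add) (simp_all add: wiener1_def wiener_def)
  then show ?eq
    using infsum_reindex_bij_betw[OF bij, of ?d]
    by (simp only: eq wiener_norm_def d weighted_norm_def)
qed

section \<open>Linear structure of \<open>CQT\<close> and uniqueness of sums\<close>

lemma CQT_diff:
  assumes "X \<in> CQT" "Y \<in> CQT"
  shows "X - Y \<in> CQT"
proof -
  obtain x E y F where xy: "x \<in> wiener1" "E \<in> Fmat" "X = toeplitz x + E"
    "y \<in> wiener1" "F \<in> Fmat" "Y = toeplitz y + F"
    using assms by (auto simp: CQT_def)
  let ?w = "\<lambda>k :: int. 1 + \<bar>real_of_int k\<bar>"
  have "x + (\<lambda>k. - 1 * y k) \<in> weighted_l1 ?w"
    using xy by (intro weighted_add weighted_scale) (simp_all add: wiener1_iff)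
  moreover have "x + (\<lambda>k. - 1 * y k) = x - y"
    by auto
  ultimately have "x - y \<in> wiener1"
    by (simp add: wiener1_iff)
  moreover have "X - Y = toeplitz (x - y) + (E - F)"
    by (simp add: xy toeplitz_def fun_eq_iff)
  ultimately show ?thesis
    using Fmat_diff[OF xy(2,5)] by (auto simp: CQT_def)
qed

lemma CQT_zero: "0 \<in> CQT"
proof -
  have "(\<lambda>_. 0) \<in> wiener1" "(0 :: semi_matrix) \<in> Fmat"
    by (simp_all add: wiener1_iff weighted_l1_def Fmat_def case_prod_unfold)
  moreover have "(0 :: semi_matrix) = toeplitz (\<lambda>_. 0) + 0"
    by (simp add: toeplitz_def fun_eq_iff)
  ultimately show ?thesis
    unfolding CQT_def by blast
qed

lemma CQT_sum:
  assumes "\<And>i. i \<in> I \<Longrightarrow> M i \<in> CQT"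
  shows "(\<Sum>i\<in>I. M i) \<in> CQT"
  using assms
proof (induction I rule: infinite_finite_induct)
  case (insert i I)
  \<comment> \<open>A sum is written as a double difference, so closure under differences and
    membership of 0 are enough.\<close>
  have "(\<Sum>i\<in>insert i I. M i) = M i - (0 - (\<Sum>i\<in>I. M i))"
    using insert by simp
  then show ?case
    using insert by (metis CQT_diff CQT_zero insertCI)
qed (simp_all add: CQT_zero)

text \<open>Convergence in \<open>cqt_norm\<close> thereby forces convergence of every entry, from
  which uniqueness of the sum of a series follows.\<close>

lemma norm_entry_le_cqt_norm:
  assumes "X \<in> CQT"
  shows "norm (X i j) \<le> cqt_norm X"
proof -
  obtain x E where X: "x \<in> wiener1" "E \<in> Fmat" "X = toeplitz x + E"
    using assms by (auto simp: CQT_def)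
  have "norm (x (int j - int i)) \<le> wiener_norm x"
    using finite_sum_le_infsum[of "\<lambda>k. norm (x k)" UNIV "{int j - int i}"] X(1)
    by (simp add: wiener_norm_def wiener1_def wiener_def)
  moreover have "norm (E i j) \<le> Fmat_norm E"
    using finite_sum_le_infsum[of "\<lambda>(i, j). norm (E i j)" UNIV "{(i, j)}"] X(2)
    by (simp add: Fmat_norm_def Fmat_def case_prod_unfold)
  ultimately have "norm (x (int j - int i) + E i j) \<le> wiener_norm x + Fmat_norm E"
    by (meson add_mono norm_triangle_le)
  then show ?thesis
    using wiener_norm_nonneg[of "laurent_deriv x"]
    by (simp add: X(3) cqt_norm_eq[OF X(1,2)]) (simp add: toeplitz_def)
qed

lemma cqt_sums_unique:
  assumes "cqt_sums M S" "cqt_sums M S'"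
  shows "S = S'"
proof -
  have lim: "(\<lambda>n. (\<Sum>m<n. M m) i j) \<longlonglongrightarrow> S i j" if S: "cqt_sums M S" for S i j
  proof -
    have "(\<Sum>m<n. M m) - S \<in> CQT" for n
      using S by (intro CQT_diff CQT_sum) (auto simp: cqt_sums_def)
    then have "norm ((\<Sum>m<n. M m) i j - S i j) \<le> cqt_norm ((\<Sum>m<n. M m) - S)" for n
      using norm_entry_le_cqt_norm[of "(\<Sum>m<n. M m) - S" i j] by simp
    then have "(\<lambda>n. (\<Sum>m<n. M m) i j - S i j) \<longlonglongrightarrow> 0"
    proof (rule Lim_null_comparison[OF always_eventually[OF allI]])
      show "(\<lambda>n. cqt_norm ((\<Sum>m<n. M m) - S)) \<longlonglongrightarrow> 0"
        using S by (simp add: cqt_sums_def)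
    qed
    then show ?thesis
      by (rule LIM_zero_cancel)
  qed
  show ?thesis
    using LIMSEQ_unique[OF lim[OF assms(1)] lim[OF assms(2)]] by (simp add: fun_eq_iff)
qed

section \<open>Evaluation of Laurent series at a point\<close>

lemma laurent_eval_weighted:
  assumes x: "x \<in> weighted_l1 w" and z: "\<And>k. norm (z powi k) \<le> w k"
  shows "(\<lambda>k. x k * z powi k) summable_on UNIV"
    and "norm (laurent_eval x z) \<le> weighted_norm w x"
proof -
  have le: "norm (x k * z powi k) \<le> w k * norm (x k)" for k
    using mult_right_mono[OF z[of k], of "norm (x k)"] by (simp add: norm_mult mult.commute)
  have sum: "(\<lambda>k. w k * norm (x k)) summable_on UNIV"
    using x by (simp add: weighted_l1_def)
  have *: "(\<lambda>k. norm (x k * z powi k)) summable_on UNIV"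
    by (rule summable_on_comparison_test[OF sum le]) simp
  then show "(\<lambda>k. x k * z powi k) summable_on UNIV"
    by (rule abs_summable_summable)
  show "norm (laurent_eval x z) \<le> weighted_norm w x"
    unfolding laurent_eval_def weighted_norm_def
    by (rule order_trans[OF norm_infsum_bound[OF *] infsum_mono[OF * sum le]])
qed

lemma laurent_eval_diff:
  assumes "(\<lambda>k. x k * z powi k) summable_on UNIV" "(\<lambda>k. y k * z powi k) summable_on UNIV"
  shows "laurent_eval (\<lambda>k. x k - y k) z = laurent_eval x z - laurent_eval y z"
  using infsum_add[OF assms(1) summable_on_uminus[THEN iffD2, OF assms(2)]]
  by (simp add: laurent_eval_def infsum_uminus left_diff_distrib)

lemma laurent_eval_sum:
  assumes "\<And>n. n \<in> I \<Longrightarrow> (\<lambda>k. x n k * z powi k) summable_on UNIV"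
  shows "laurent_eval (\<lambda>k. \<Sum>n\<in>I. x n k) z = (\<Sum>n\<in>I. laurent_eval (x n) z)"
proof -
  have "((\<lambda>k. (\<Sum>n\<in>I. x n k) * z powi k) has_sum (\<Sum>n\<in>I. laurent_eval (x n) z)) UNIV"
    using assms
  proof (induction I rule: infinite_finite_induct)
    case (insert n I)
    then show ?case
      using has_sum_add[OF has_sum_infsum[of "\<lambda>k. x n k * z powi k" UNIV] insert.IH]
      by (simp add: laurent_eval_def distrib_right)
  qed auto
  then show ?thesis
    unfolding laurent_eval_def[of "\<lambda>k. \<Sum>n\<in>I. x n k"] by (rule infsumI)
qed

text \<open>Evaluation takes the partial sums of the symbol series to those of the power series at
  a(z), and it is continuous for the weighted norm. Since b is defined coefficientwise,
  independently of w, the same symbol serves the circle and every admissible annulus.\<close>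

lemma laurent_eval_series:
  fixes w :: "int \<Rightarrow> real"
  assumes w: "\<And>k. 1 \<le> w k" and sub: "\<And>j k. w (j + k) \<le> w j * w k" and w0: "w 0 = 1"
    and a: "a \<in> weighted_l1 w" and B: "summable (\<lambda>n. norm (c n) * weighted_norm w a ^ n)"
  defines "b \<equiv> \<lambda>k. \<Sum>n. c n * conv_pow a n k"
  shows "b \<in> weighted_l1 w"
    and "z \<noteq> 0 \<Longrightarrow> (\<And>k. norm (z powi k) \<le> w k) \<Longrightarrow> (\<lambda>n. c n * laurent_eval a z ^ n) sums laurent_eval b z"
proof -
  have wpos: "0 < w k" for k
    using w[of k] by linarith
  note pow = conv_pow_weighted[OF wpos sub w0 a]
  define u where "u = (\<lambda>n k. c n * conv_pow a n k)"
  have u: "u n \<in> weighted_l1 w" for n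
    using pow[of n] by (simp add: u_def weighted_scale)
  have le: "weighted_norm w (u n) \<le> norm (c n) * weighted_norm w a ^ n" for n
    using pow[of n] by (simp add: u_def weighted_scale mult_left_mono)
  have b: "b k = (\<Sum>n. u n k)" for k
    by (simp add: b_def u_def)
  note series = weighted_series[OF w u le B b]
  show bw: "b \<in> weighted_l1 w"
    by (rule series(1))
  assume z: "z \<noteq> 0" "\<And>k. norm (z powi k) \<le> w k"
  note summable = laurent_eval_weighted(1)[OF _ z(2)]
  have "laurent_eval (conv_pow a n) z = laurent_eval a z ^ n" for n
  proof (induction n)
    case 0
    have "((\<lambda>k. (if k = 0 then 1 else 0) * z powi k) has_sum 1) UNIV"
      by (rule has_sum_finite_neutralI[of "{0}"]) auto
    then show ?case
      by (simp add: laurent_eval_def infsumI)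
  next
    case (Suc n)
    then show ?case
      using laurent_eval_conv[OF summable[OF a] summable z(1)] pow[of n] by simp
  qed
  then have eval_u: "laurent_eval (u n) z = c n * laurent_eval a z ^ n" for n
    by (simp add: u_def laurent_eval_def infsum_cmult_right' mult.assoc)
  have uN: "(\<lambda>k. \<Sum>n<N. u n k) \<in> weighted_l1 w" for N
  proof (induction N)
    case 0
    show ?case
      by (simp add: weighted_l1_def)
  next
    case (Suc N)
    have "(\<lambda>k. \<Sum>n<Suc N. u n k) = (\<lambda>k. \<Sum>n<N. u n k) + u N"
      by auto
    then show ?case
      using weighted_add(1)[OF less_imp_le[OF wpos] Suc u] by simp
  qed
  have "norm ((\<Sum>n<N. c n * laurent_eval a z ^ n) - laurent_eval b z)
      \<le> weighted_norm w (\<lambda>k. (\<Sum>n<N. u n k) - b k)" for N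
    using laurent_eval_weighted(2)[OF series(3)[of N] z(2)]
      laurent_eval_diff[OF summable[OF uN[of N]] summable[OF bw]] laurent_eval_sum[where I = "{..<N}", OF summable[OF u]]
    by (simp add: eval_u)
  then have "(\<lambda>N. (\<Sum>n<N. c n * laurent_eval a z ^ n) - laurent_eval b z) \<longlonglongrightarrow> 0"
    by (rule Lim_null_comparison[OF always_eventually[OF allI] series(2)])
  then show "(\<lambda>n. c n * laurent_eval a z ^ n) sums laurent_eval b z"
    unfolding sums_def by (rule LIM_zero_cancel)
qed

text \<open>The symbol and the correction of the n-th power each have norm at most
  \<open>cqt_norm A ^ n\<close>. Hence \<open>weighted_series\<close> sums both with the same
  majorant, once over integers with weight 1 + |k| and once over index pairs with weight 1.\<close>

lemma cqt_powser:
  assumes a: "a \<in> wiener1" and E: "E \<in> Fmat"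
  defines "A \<equiv> toeplitz a + E"
  assumes B: "summable (\<lambda>n. norm (c n) * cqt_norm A ^ n)"
  shows "\<exists>E'\<in>Fmat. cqt_sums (\<lambda>i. mat_scale (c i) (mat_pow A i)) (toeplitz (\<lambda>k. \<Sum>n. c n * conv_pow a n k) + E')"
    and "(\<lambda>k. \<Sum>n. c n * conv_pow a n k) \<in> wiener1"
proof -
  let ?w = "\<lambda>k :: int. 1 + \<bar>real_of_int k\<bar>"
  define u where "u = (\<lambda>n k. c n * conv_pow a n k)"
  define R where "R n = mat_pow A n - toeplitz (conv_pow a n)" for n
  define V where "V = (\<lambda>n (i, j). mat_scale (c n) (R n) i j)"
  define b where "b = (\<lambda>k. \<Sum>n. u n k)"
  define e where "e = (\<lambda>x. \<Sum>n. V n x)"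
  define E' where "E' = (\<lambda>i j. e (i, j))"
  have pow: "conv_pow a n \<in> wiener1" "R n \<in> Fmat" "cqt_norm (mat_pow A n) \<le> cqt_norm A ^ n" for n
    using cqt_pow[OF a E] by (auto simp: A_def R_def)
  have split: "mat_pow A n = toeplitz (conv_pow a n) + R n" for n
    by (simp add: R_def)
  have nm: "weighted_norm ?w (conv_pow a n) + Fmat_norm (R n) \<le> cqt_norm A ^ n" for n
    using pow(3)[of n] unfolding split cqt_norm_eq[OF pow(1,2)] by (simp add: wiener1_norm_eq pow)
  have nm1: "weighted_norm ?w (conv_pow a n) \<le> cqt_norm A ^ n" for n
    using nm[of n] Fmat_norm_nonneg[of "R n"] by linarith
  have nm2: "Fmat_norm (R n) \<le> cqt_norm A ^ n" for n
    using nm[of n] weighted_norm_nonneg[of ?w "conv_pow a n"] by simp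
  have u: "u n \<in> weighted_l1 ?w" "weighted_norm ?w (u n) \<le> norm (c n) * cqt_norm A ^ n" for n
    using nm1[of n] pow(1)[of n] by (simp_all add: u_def weighted_scale wiener1_iff mult_left_mono)
  have V: "V n \<in> weighted_l1 (\<lambda>_. 1)" "weighted_norm (\<lambda>_. 1) (V n) \<le> norm (c n) * cqt_norm A ^ n" for n
    using nm2[of n] Fmat_mat_scale[OF pow(2)[of n], of "c n"]
    by (simp_all add: V_def Fmat_iff Fmat_norm_eq mult_left_mono)
  note bs = weighted_series[where w = ?w, OF _ u B fun_cong[OF b_def], simplified]
  note es = weighted_series[where w = "\<lambda>_. 1", OF _ V B fun_cong[OF e_def], simplified]
  have b1: "b \<in> wiener1"
    using bs(1) by (simp add: wiener1_iff)
  then show "(\<lambda>k. \<Sum>n. c n * conv_pow a n k) \<in> wiener1"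
    by (simp add: b_def u_def)
  have E': "E' \<in> Fmat"
    using es(1) by (simp add: E'_def Fmat_iff case_prod_unfold)
  have "mat_scale (c n) (mat_pow A n) = toeplitz (u n) + mat_scale (c n) (R n)" for n
    by (simp add: split mat_scale_def u_def toeplitz_def fun_eq_iff algebra_simps)
  then have C: "mat_scale (c n) (mat_pow A n) \<in> CQT" for n
    using u(1)[of n] Fmat_mat_scale(1)[OF pow(2)[of n], of "c n"] by (auto simp: CQT_def wiener1_iff)
  have diff: "(\<Sum>n<N. mat_scale (c n) (mat_pow A n)) - (toeplitz b + E')
      = toeplitz (\<lambda>k. (\<Sum>n<N. u n k) - b k) + (\<lambda>i j. (\<Sum>n<N. V n (i, j)) - e (i, j))" for N
    by (auto simp: fun_eq_iff sum_fun_apply split mat_scale_def toeplitz_def u_def V_def E'_def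
        algebra_simps sum.distrib)
  have "cqt_norm ((\<Sum>n<N. mat_scale (c n) (mat_pow A n)) - (toeplitz b + E'))
      = weighted_norm ?w (\<lambda>k. (\<Sum>n<N. u n k) - b k) + weighted_norm (\<lambda>_. 1) (\<lambda>x. (\<Sum>n<N. V n x) - e x)" for N
  proof -
    have 1: "(\<lambda>k. (\<Sum>n<N. u n k) - b k) \<in> wiener1"
      using bs(3)[of N] by (simp add: wiener1_iff)
    have 2: "(\<lambda>i j. (\<Sum>n<N. V n (i, j)) - e (i, j)) \<in> Fmat"
      using es(3)[of N] by (simp add: Fmat_iff case_prod_unfold)
    show ?thesis
      unfolding diff cqt_norm_eq[OF 1 2] wiener1_norm_eq[OF 1] by (simp add: Fmat_norm_eq case_prod_unfold)
  qed
  then have "(\<lambda>N. cqt_norm ((\<Sum>n<N. mat_scale (c n) (mat_pow A n)) - (toeplitz b + E'))) \<longlonglongrightarrow> 0"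
    using tendsto_add[OF bs(2) es(2)] by simp
  then have "cqt_sums (\<lambda>i. mat_scale (c i) (mat_pow A i)) (toeplitz b + E')"
    using C b1 E' by (auto simp: cqt_sums_def CQT_def)
  then show "\<exists>E'\<in>Fmat. cqt_sums (\<lambda>i. mat_scale (c i) (mat_pow A i)) (toeplitz (\<lambda>k. \<Sum>n. c n * conv_pow a n k) + E')"
    using E' by (auto simp: b_def u_def)
qed

section \<open>Symbols analytic in an annulus\<close>

text \<open>This is convexity of x^n between 1 and s. The induction works because the product of the
  two chords falls short of the new chord by l (1 - l) (s - 1) (s^n - 1), which is
  nonnegative.\<close>

lemma power_convex_bound:
  fixes l s :: real
  assumes "0 \<le> l" "l \<le> 1" "1 \<le> s"
  shows "(1 - l + l * s) ^ n \<le> 1 - l + l * s ^ n"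
proof (induction n)
  case (Suc n)
  have "(1 - l + l * s) ^ Suc n \<le> (1 - l + l * s) * (1 - l + l * s ^ n)"
    using assms Suc by (simp add: mult_left_mono)
  also have "\<dots> = 1 - l + l * s ^ Suc n - l * (1 - l) * ((s - 1) * (s ^ n - 1))"
    by (simp add: algebra_simps)
  also have "\<dots> \<le> 1 - l + l * s ^ Suc n"
    using assms by simp
  finally show ?case .
qed simp

text \<open>With t = 1 - l + l s, convexity puts the norm at t below the chord joining the Wiener
  norm to the norm at s. A small l keeps that chord under \<rho>.\<close>

lemma weighted_norm_radius:
  assumes a: "a \<in> weighted_l1 (\<lambda>k. s ^ nat \<bar>k\<bar>)" and s: "1 < s" and "wiener_norm a < \<rho>"
  obtains t where "1 < t" "t \<le> s" "a \<in> weighted_l1 (\<lambda>k. t ^ nat \<bar>k\<bar>)"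
    "weighted_norm (\<lambda>k. t ^ nat \<bar>k\<bar>) a < \<rho>"
proof -
  let ?W = "\<lambda>t (k :: int). t ^ nat \<bar>k\<bar>"
  have sm: "(\<lambda>k. ?W s k * norm (a k)) summable_on UNIV"
    using a by (simp add: weighted_l1_def)
  have mono: "?W t k * norm (a k) \<le> ?W s k * norm (a k)" if "1 \<le> t" "t \<le> s" for t k
    using that by (intro mult_right_mono power_mono) auto
  have smt: "(\<lambda>k. ?W t k * norm (a k)) summable_on UNIV" if "1 \<le> t" "t \<le> s" for t
    by (rule summable_on_comparison_test[OF sm mono[OF that]]) (use that in auto)
  have a1: "(\<lambda>k. norm (a k)) summable_on UNIV"
    using smt[of 1] s by simp
  define d where "d = \<rho> - wiener_norm a"
  define e where "e = weighted_norm (?W s) a - wiener_norm a"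
  have "wiener_norm a \<le> weighted_norm (?W s) a"
    unfolding wiener_norm_def weighted_norm_def
    by (rule infsum_mono[OF a1 sm]) (use mono[of 1] s in simp)
  then have de: "0 < d" "0 \<le> e"
    using assms(3) by (simp_all add: d_def e_def)
  \<comment> \<open>The chord rises by l e and the room available is d, so l e < d is required; the
    added 1 keeps l < 1 even when e = 0.\<close>
  define l where "l = d / (d + e + 1)"
  have l: "0 < l" "l < 1" "l * e < d"
    using de by (simp_all add: l_def field_simps add_pos_nonneg)
  define t where "t = 1 - l + l * s"
  have "t - 1 = l * (s - 1)" "s - t = (1 - l) * (s - 1)"
    by (simp_all add: t_def algebra_simps)
  moreover have "0 < l * (s - 1)" "0 < (1 - l) * (s - 1)"
    using l s by simp_all
  ultimately have t: "1 < t" "t \<le> s"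
    by linarith+
  have "weighted_norm (?W t) a \<le> (\<Sum>\<^sub>\<infinity>k. (1 - l) * norm (a k) + l * (?W s k * norm (a k)))"
    unfolding weighted_norm_def
  proof (rule infsum_mono)
    show "(\<lambda>k. ?W t k * norm (a k)) summable_on UNIV"
      using smt t by simp
    show "(\<lambda>k. (1 - l) * norm (a k) + l * (?W s k * norm (a k))) summable_on UNIV"
      by (intro summable_on_add summable_on_cmult_right a1 sm)
    show "?W t k * norm (a k) \<le> (1 - l) * norm (a k) + l * (?W s k * norm (a k))" for k
      using mult_right_mono[OF power_convex_bound[of l s "nat \<bar>k\<bar>"], of "norm (a k)"] l s
      by (simp add: t_def algebra_simps)
  qed
  also have "\<dots> = (1 - l) * wiener_norm a + l * weighted_norm (?W s) a"
    unfolding wiener_norm_def weighted_norm_def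
    by (simp add: infsum_add a1 sm summable_on_cmult_right infsum_cmult_right')
  also have "\<dots> = wiener_norm a + l * e"
    by (simp add: e_def algebra_simps)
  also have "\<dots> < \<rho>"
    using l(3) by (simp add: d_def)
  finally have "weighted_norm (?W t) a < \<rho>" .
  moreover have "a \<in> weighted_l1 (?W t)"
    using smt t by (simp add: weighted_l1_def)
  ultimately show ?thesis
    using that t by blast
qed

lemma powi_le_power_abs:
  fixes z :: complex
  assumes t: "1 \<le> t" and z: "1 / t \<le> norm z" "norm z \<le> t"
  shows "norm (z powi k) \<le> t ^ nat \<bar>k\<bar>"
proof (cases "0 \<le> k")
  case True
  then show ?thesis
    using z(2) by (simp add: power_int_def norm_power power_mono)
next
  case False
  have "0 < norm z"
    using t z(1) by (smt (verit) divide_pos_pos)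
  then have "inverse (norm z) \<le> t"
    using t z(1) by (simp add: field_simps)
  then show ?thesis
    using False by (simp add: power_int_def norm_power norm_inverse power_mono)
qed

text \<open>Two real points of the annulus suffice: s^|k| is at most s^k + s^(-k), and the Laurent
  series converges absolutely at both s and 1/s.\<close>

lemma laurent_analytic_imp_weighted:
  assumes "laurent_analytic_on a (annulus r R)" "r < 1" "1 < R" "0 \<le> r"
  obtains s where "1 < s" "s < R" "r < 1 / s" "a \<in> weighted_l1 (\<lambda>k. s ^ nat \<bar>k\<bar>)"
proof -
  have "max r (1 / R) < 1"
    using assms by simp
  \<comment> \<open>With q above both r and 1/R and below 1, the points q and s = 1/q both lie in
    the annulus.\<close>
  then obtain q where q: "max r (1 / R) < q" "q < 1"
    using dense by blast
  have q0: "0 < q"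
    using q(1) assms by (auto simp: max_def split: if_splits)
  define s where "s = 1 / q"
  have s: "1 < s" "s < R" "r < 1 / s"
    using q q0 assms by (auto simp: s_def field_simps)
  have 1: "(\<lambda>k. a k * complex_of_real x powi k) summable_on UNIV" if "r < x" "x < R" for x
    using assms that by (auto simp: laurent_analytic_on_def annulus_def)
  have 2: "(\<lambda>k. norm (a k * complex_of_real x powi k)) summable_on UNIV" if "r < x" "x < R" for x
    using 1[OF that] by (rule iffD1[OF summable_on_iff_abs_summable_on_complex])
  have "1 / s < R" "r < s"
    using s assms by (auto simp: field_simps intro: less_trans)
  then have sum: "(\<lambda>k. norm (a k * complex_of_real s powi k) + norm (a k * complex_of_real (1 / s) powi k)) summable_on UNIV"
    using s by (intro summable_on_add 2) auto
  have "(\<lambda>k. s ^ nat \<bar>k\<bar> * norm (a k)) summable_on UNIV"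
  proof (rule summable_on_comparison_test[OF sum])
    fix k :: int
    have "s ^ nat \<bar>k\<bar> \<le> s powi k + (1 / s) powi k"
      using s by (auto simp: power_int_def field_simps abs_if)
    then show "s ^ nat \<bar>k\<bar> * norm (a k) \<le> norm (a k * complex_of_real s powi k) + norm (a k * complex_of_real (1 / s) powi k)"
      using s mult_right_mono[of "s ^ nat \<bar>k\<bar>" "s powi k + (1 / s) powi k" "norm (a k)"]
      by (simp add: norm_mult norm_power_int algebra_simps norm_divide)
  qed (use s in simp)
  then show ?thesis
    using that s by (simp add: weighted_l1_def)
qed

text \<open>Bernoulli's inequality bounds 1 + |k| by a constant multiple of s^|k|. Thus a symbol
  analytic near the circle belongs to \<open>wiener1\<close>, where the decomposition of a matrix is
  unique.\<close>

lemma geometric_weighted_imp_wiener1: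
  assumes a: "a \<in> weighted_l1 (\<lambda>k. s ^ nat \<bar>k\<bar>)" and s: "1 < s"
  shows "a \<in> wiener1"
proof -
  define m where "m = min 1 (s - 1)"
  have m: "0 < m" "m \<le> 1" "m \<le> s - 1"
    using s by (auto simp: m_def)
  have le: "1 + \<bar>of_int k\<bar> \<le> inverse m * s ^ nat \<bar>k\<bar>" for k
  proof -
    have "m * (1 + real (nat \<bar>k\<bar>)) \<le> 1 + real (nat \<bar>k\<bar>) * (s - 1)"
      using m mult_left_mono[of m "s - 1" "real (nat \<bar>k\<bar>)"] by (simp add: algebra_simps)
    also have "\<dots> \<le> s ^ nat \<bar>k\<bar>"
      using Bernoulli_inequality[of "s - 1" "nat \<bar>k\<bar>"] s by simp
    finally show ?thesis
      using m by (simp add: field_simps)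
  qed
  have "(\<lambda>k. inverse m * (s ^ nat \<bar>k\<bar> * norm (a k))) summable_on UNIV"
    using a by (intro summable_on_cmult_right) (simp add: weighted_l1_def)
  then have "(\<lambda>k. (1 + \<bar>of_int k\<bar>) * norm (a k)) summable_on UNIV"
    by (rule summable_on_comparison_test) (use mult_right_mono[OF le] in \<open>auto simp: mult.assoc\<close>)
  then show ?thesis
    by (simp add: wiener1_iff weighted_l1_def)
qed

theorem theorem3p1:
  fixes A E :: semi_matrix and a :: laurent
    and f :: "complex \<Rightarrow> complex" and c :: "nat \<Rightarrow> complex" and \<rho> :: real
  assumes "a \<in> wiener1" and "E \<in> Fmat" and "A = toeplitz a + E"
    and "f analytic_on ball 0 \<rho>"
    and "\<And>x. x \<in> ball 0 \<rho> \<Longrightarrow> (\<lambda>i. c i * x ^ i) sums f x"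
    and "cqt_norm A < \<rho>"
  shows "(\<exists>!S. cqt_sums (\<lambda>i. mat_scale (c i) (mat_pow A i)) S)
    \<and> mat_powser c A \<in> CQT
    \<and> (\<forall>z\<in>sphere 0 1. laurent_eval a z \<in> ball 0 \<rho>)
    \<and> (\<exists>b\<in>wiener1. \<exists>E'\<in>Fmat.
          (\<forall>z\<in>sphere 0 1. laurent_eval b z = f (laurent_eval a z))
          \<and> mat_powser c A = toeplitz b + E')
    \<and> (A \<in> AQT \<longrightarrow>
          mat_powser c A \<in> AQT
          \<and> (\<exists>r R. 0 \<le> r \<and> r < 1 \<and> 1 < R
                \<and> laurent_analytic_on a (annulus r R)
                \<and> (\<forall>z\<in>annulus r R. laurent_eval a z \<in> ball 0 \<rho>)
                \<and> (\<lambda>z. f (laurent_eval a z)) analytic_on annulus r R))"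
proof -
  note a = assms(1) and E = assms(2) and A = assms(3)
  define b where "b = (\<lambda>k. \<Sum>n. c n * conv_pow a n k)"
  \<comment> \<open>The series converges at a real point y strictly between x and \<rho>, hence
    absolutely at x.\<close>
  have geom: "summable (\<lambda>n. norm (c n) * x ^ n)" if "0 \<le> x" "x < \<rho>" for x
  proof -
    obtain y where y: "x < y" "y < \<rho>"
      using dense[OF \<open>x < \<rho>\<close>] by blast
    have "summable (\<lambda>n. c n * complex_of_real y ^ n)"
      using assms(5)[of "complex_of_real y"] y that by (auto simp: sums_iff)
    then have "summable (\<lambda>n. norm (c n * complex_of_real x ^ n))"
      by (rule powser_insidea) (use y that in simp)
    then show ?thesis
      using that by (simp add: norm_mult norm_power)
  qed
  have norm_le: "wiener_norm a \<le> cqt_norm A"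
    using cqt_norm_eq[OF a E] wiener_norm_nonneg[of "laurent_deriv a"] Fmat_norm_nonneg[of E] by (simp add: A)
  then have N: "0 \<le> cqt_norm A" "wiener_norm a < \<rho>"
    using wiener_norm_nonneg[of a] assms(6) by simp_all
  obtain E' where E': "E' \<in> Fmat"
    and sums: "cqt_sums (\<lambda>i. mat_scale (c i) (mat_pow A i)) (toeplitz b + E')" and b: "b \<in> wiener1"
    using cqt_powser[OF a E, of c] geom[OF N(1) assms(6)] unfolding A b_def by blast
  have S: "mat_powser c A = toeplitz b + E'"
    unfolding mat_powser_def cqt_suminf_def using sums cqt_sums_unique by blast
  \<comment> \<open>One statement covers both claims: t = 1 gives the unit circle with the Wiener
    norm, and t > 1 an annulus around it.\<close>
  have eval: "laurent_eval b z = f (laurent_eval a z)" "laurent_eval a z \<in> ball 0 \<rho>"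
    "(\<lambda>k. a k * z powi k) summable_on UNIV" "(\<lambda>k. b k * z powi k) summable_on UNIV"
    if t: "1 \<le> t" and at: "a \<in> weighted_l1 (\<lambda>k. t ^ nat \<bar>k\<bar>)"
      "weighted_norm (\<lambda>k. t ^ nat \<bar>k\<bar>) a < \<rho>" and z: "1 / t \<le> norm z" "norm z \<le> t" for t z
  proof -
    let ?w = "\<lambda>k :: int. t ^ nat \<bar>k\<bar>"
    have "z \<noteq> 0"
      using z t by (auto simp: divide_le_0_iff)
    note powi = powi_le_power_abs[OF t z]
    have sub: "?w (j + k) \<le> ?w j * ?w k" for j k
      using t by (auto simp flip: power_add intro!: power_increasing)
    have sm: "summable (\<lambda>n. norm (c n) * weighted_norm ?w a ^ n)"
      using t at by (intro geom weighted_norm_nonneg) auto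
    note series = laurent_eval_series[OF one_le_power[OF t] sub _ at(1) sm, simplified, folded b_def]
    show in_ball: "laurent_eval a z \<in> ball 0 \<rho>"
      using laurent_eval_weighted(2)[OF at(1) powi] at(2) by simp
    show "laurent_eval b z = f (laurent_eval a z)"
      using sums_unique2[OF series(2)[OF \<open>z \<noteq> 0\<close> powi] assms(5)[OF in_ball]] .
    show "(\<lambda>k. a k * z powi k) summable_on UNIV" "(\<lambda>k. b k * z powi k) summable_on UNIV"
      using laurent_eval_weighted(1)[OF _ powi] at(1) series(1) by auto
  qed
  have circle: "laurent_eval b z = f (laurent_eval a z)" "laurent_eval a z \<in> ball 0 \<rho>" if "z \<in> sphere 0 1" for z
    using eval(1,2)[of 1 z] that a N(2) by (simp_all add: wiener1_def wiener_iff wiener_norm_eq)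
  have AQT: "mat_powser c A \<in> AQT \<and> (\<exists>r R. 0 \<le> r \<and> r < 1 \<and> 1 < R
                \<and> laurent_analytic_on a (annulus r R)
                \<and> (\<forall>z\<in>annulus r R. laurent_eval a z \<in> ball 0 \<rho>)
                \<and> (\<lambda>z. f (laurent_eval a z)) analytic_on annulus r R)" if "A \<in> AQT"
  proof -
    obtain a' F r R where F: "A = toeplitz a' + F" "F \<in> Fmat" and r: "0 \<le> r" "r < 1" "1 < R"
      and an: "laurent_analytic_on a' (annulus r R)"
      using \<open>A \<in> AQT\<close> by (auto simp: AQT_def)
    obtain s where s: "1 < s" "s < R" "r < 1 / s" "a' \<in> weighted_l1 (\<lambda>k. s ^ nat \<bar>k\<bar>)"
      using laurent_analytic_imp_weighted[OF an r(2,3,1)] by blast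
    \<comment> \<open>The symbol a' supplied by \<open>AQT\<close> need not be the given a at the
      outset; uniqueness of the decomposition within \<open>CQT\<close> identifies them.\<close>
    have "cqt_symbol A = a'"
      unfolding F(1) by (rule cqt_symbol_eq[OF geometric_weighted_imp_wiener1[OF s(4,1)] F(2)])
    moreover have "cqt_symbol A = a"
      unfolding A by (rule cqt_symbol_eq[OF a E])
    ultimately have aa: "a' = a"
      by simp
    obtain t where t: "1 < t" "t \<le> s" "a \<in> weighted_l1 (\<lambda>k. t ^ nat \<bar>k\<bar>)"
      "weighted_norm (\<lambda>k. t ^ nat \<bar>k\<bar>) a < \<rho>"
      using weighted_norm_radius[OF s(4)[unfolded aa] s(1) N(2)] by blast
    let ?S = "annulus (1 / t) t"
    have "1 / s \<le> 1 / t"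
      using t by (simp add: frac_le)
    then have sub: "?S \<subseteq> annulus r R"
      using s t by (auto simp: annulus_def)
    have ev: "laurent_eval b z = f (laurent_eval a z)" "laurent_eval a z \<in> ball 0 \<rho>"
      "(\<lambda>k. b k * z powi k) summable_on UNIV" if "z \<in> ?S" for z
      using eval[of t z] t that by (simp_all add: annulus_def)
    have ana: "laurent_analytic_on a ?S"
      using an sub analytic_on_subset unfolding laurent_analytic_on_def aa by blast
    have comp: "(\<lambda>z. f (laurent_eval a z)) analytic_on ?S"
      using analytic_on_compose_gen[of "laurent_eval a" ?S f "ball 0 \<rho>"] ana assms(4) ev(2)
      by (simp add: laurent_analytic_on_def o_def)
    have "?S = norm -` {1 / t<..<t}"
      by (auto simp: annulus_def)
    then have "open ?S"
      using open_vimage[OF open_greaterThanLessThan continuous_on_norm_id] by metis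
    \<comment> \<open>On an open set analyticity is holomorphy, which depends only on the values
      there, so it passes from the composite of f and a to b.\<close>
    then have "laurent_eval b analytic_on ?S"
      using comp ev(1) by (simp add: analytic_on_open cong: holomorphic_cong)
    then have "laurent_analytic_on b ?S"
      using ev(3) by (simp add: laurent_analytic_on_def)
    moreover have r': "0 \<le> 1 / t" "1 / t < 1"
      using t by simp_all
    ultimately have "mat_powser c A \<in> AQT"
      unfolding AQT_def S using E' t(1) by blast
    then show ?thesis
      using ana ev(2) comp r' t(1) by blast
  qed
  show ?thesis
  proof (intro conjI)
    show "\<exists>!S. cqt_sums (\<lambda>i. mat_scale (c i) (mat_pow A i)) S"
      using sums cqt_sums_unique by blast
    show "mat_powser c A \<in> CQT"
      using sums unfolding S cqt_sums_def by blast
    show "\<exists>b\<in>wiener1. \<exists>E'\<in>Fmat. (\<forall>z\<in>sphere 0 1. laurent_eval b z = f (laurent_eval a z))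
        \<and> mat_powser c A = toeplitz b + E'"
      using b E' circle(1) S by blast
  qed (use circle(2) AQT in blast)+
qed

end
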